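(* Let $X$ be a scheme of finite type over $\mathbb{Z}$, $d=\dim X$, and fix an integer $r$. Assume that the groups $CH^r(X,i)$ can be defined for $X$ and have finite ranks, and suppose that there is an integer $N$ such that $\mathrm{rk}(CH^r(X,n))=0$ for all $n\ge N$. Then the conjecture of Soulé, $$-\mathrm{ord}_{s=d-r}\,\zeta_X(s)=\sum_i(-1)^i\,\mathrm{rk}(CH^r(X,i)),$$ is true if and only if $$\mathrm{ord}_{s=d-r}\,\zeta_X(s)=(-1)^N\,\mathrm{rk}(CHC^r(X,N-1))+(-1)^{N+1}\,\mathrm{rk}(CHC^r(X,N)).$$
   Context: $\zeta_X(s)$ is the zeta function $\prod_x(1-N(x)^{-s})^{-1}$ over the closed points of $X$ (with $N(x)$ the cardinality of the residue field), assumed to be meromorphic at $s=d-r$, and $\mathrm{ord}$ is its order of vanishing there. That $CH^r(X,i)$ "can be defined" means that Bloch's codimension-$r$ cycle groups $C_n=\mathcal{Z}^r(X,n)$ ($n\ge0$; generated by cycles on $X\times\Delta^n$ meeting all faces properly) are available as a precyclic abelian group with the last degeneracy, and $CH^r(X,n)=H_n(C_\bullet,\partial)$. Here a precyclic object with the last degeneracy consists of $d_i:C_n\to C_{n-1}$ ($0\le i\le n$), $T_n:C_n\to C_n$, $s_n:C_n\to C_{n+1}$ with $d_id_j=d_{j-1}d_i$ for $i<j$; $T_n^{n+1}=\mathrm{id}$, $d_0T_n=d_n$, $d_iT_n=T_{n-1}d_{i-1}$ for $1\le i\le n$; $d_is_n=s_{n-1}d_i$ for $i\le n-1$ and $d_ns_n=d_{n+1}s_n=\mathrm{id}$.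 Put $t=(-1)^nT_n$, $\mathbf{N}=1+t+\cdots+t^n$ on $C_n$, $\partial=\sum_{i=0}^n(-1)^id_i$, $\partial'=\sum_{i=0}^{n-1}(-1)^id_i$. $CHC^r(X,n)$ is the $n$-th homology of the total complex of the first quadrant bicomplex with $CC_{a,m}=C_m$ ($a,m\ge0$), vertical differential $\partial$ ($a$ even) or $-\partial'$ ($a$ odd), horizontal differential $CC_{a,m}\to CC_{a-1,m}$ equal to $1-t$ ($a$ odd) or $\mathbf{N}$ ($a\ge2$ even). Groups with negative second index are zero. *)

theory Defs
  imports
    "HOL-Algebra.Algebra"
    "HOL-Algebra.Free_Abelian_Groups"
    "HOL-Algebra.Indexed_Polynomials"
    "HOL-Algebra.Product_Groups"
    "HOL-Complex_Analysis.Complex_Analysis"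
    "HOL-Library.Extended_Nat"
    "HOL-Library.Groups_Big_Fun"
begin

section \<open>Commutative algebra\<close>

text \<open>The fraction \<open>a/b\<close> in the localization \<open>R\<^sub>Q\<close> at a prime ideal \<open>Q\<close>, as an equivalence class of
  pairs (numerator, denominator). The ring operations below are unions of a single class.\<close>

definition fraction :: "'a ring \<Rightarrow> 'a set \<Rightarrow> 'a \<Rightarrow> 'a \<Rightarrow> ('a \<times> 'a) set" where
  "fraction R Q a b = {(c, e). c \<in> carrier R \<and> e \<in> carrier R - Q \<and>
     (\<exists>u \<in> carrier R - Q. u \<otimes>\<^bsub>R\<^esub> (a \<otimes>\<^bsub>R\<^esub> e \<ominus>\<^bsub>R\<^esub> c \<otimes>\<^bsub>R\<^esub> b) = \<zero>\<^bsub>R\<^esub>)}"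

definition localization :: "'a ring \<Rightarrow> 'a set \<Rightarrow> ('a \<times> 'a) set ring" where
  "localization R Q =
    \<lparr> carrier = {fraction R Q a b | a b. a \<in> carrier R \<and> b \<in> carrier R - Q},
      monoid.mult = (\<lambda>A B. \<Union>(a, b)\<in>A. \<Union>(c, e)\<in>B. fraction R Q (a \<otimes>\<^bsub>R\<^esub> c) (b \<otimes>\<^bsub>R\<^esub> e)),
      one = fraction R Q \<one>\<^bsub>R\<^esub> \<one>\<^bsub>R\<^esub>,
      ring.zero = fraction R Q \<zero>\<^bsub>R\<^esub> \<one>\<^bsub>R\<^esub>,
      add = (\<lambda>A B. \<Union>(a, b)\<in>A. \<Union>(c, e)\<in>B.
               fraction R Q (a \<otimes>\<^bsub>R\<^esub> e \<oplus>\<^bsub>R\<^esub> c \<otimes>\<^bsub>R\<^esub> b) (b \<otimes>\<^bsub>R\<^esub> e)) \<rparr>"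

text \<open>The polynomial ring over \<open>R\<close> in the variables \<open>V\<close>; monomials are multisets of variables.\<close>

definition mpoly_ring :: "'a ring \<Rightarrow> 'v set \<Rightarrow> ('v multiset \<Rightarrow> 'a) ring" where
  "mpoly_ring R V =
    \<lparr> carrier = ring.indexed_pset R V (carrier R),
      monoid.mult = (\<lambda>p q m. finsum R (\<lambda>a. p a \<otimes>\<^bsub>R\<^esub> q (m - a)) {a. a \<subseteq># m}),
      one = ring.indexed_const R \<one>\<^bsub>R\<^esub>,
      ring.zero = ring.indexed_const R \<zero>\<^bsub>R\<^esub>,
      add = ring.indexed_padd R \<rparr>"

text \<open>The length of a commutative ring as a module over itself (submodules are ideals).\<close>

definition ring_length :: "'a ring \<Rightarrow> enat" where
  "ring_length R = Sup {enat k | k. \<exists>Is. length Is = Suc k \<and>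
     (\<forall>I \<in> set Is. ideal I R) \<and> sorted_wrt (\<subset>) Is}"

definition finitely_generated_ring :: "'a ring \<Rightarrow> bool" where
  "finitely_generated_ring R \<longleftrightarrow>
     (\<exists>S. finite S \<and> S \<subseteq> carrier R \<and> generate_ring R S = carrier R)"

section \<open>Dimension theory of topological spaces\<close>

definition irreducible_closed :: "'p topology \<Rightarrow> 'p set \<Rightarrow> bool" where
  "irreducible_closed T Z \<longleftrightarrow> closedin T Z \<and> Z \<noteq> {} \<and>
     (\<forall>A B. closedin T A \<and> closedin T B \<and> Z \<subseteq> A \<union> B \<longrightarrow> Z \<subseteq> A \<or> Z \<subseteq> B)"

definition irreducible_components :: "'p topology \<Rightarrow> 'p set \<Rightarrow> 'p set set" where
  "irreducible_components T S = {W. irreducible_closed T W \<and> W \<subseteq> S \<and>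
     (\<forall>W'. irreducible_closed T W' \<and> W \<subseteq> W' \<and> W' \<subseteq> S \<longrightarrow> W' = W)}"

text \<open>With this definition the empty space gets dimension 0; this affects no other space.\<close>

definition krull_dim :: "'p topology \<Rightarrow> enat" where
  "krull_dim T = Sup {enat k | k. \<exists>Zs. length Zs = Suc k \<and>
     (\<forall>Z \<in> set Zs. irreducible_closed T Z) \<and> sorted_wrt (\<subset>) Zs}"

text \<open>Codimension of an irreducible closed subset.\<close>

definition codim :: "'p topology \<Rightarrow> 'p set \<Rightarrow> enat" where
  "codim T Z = Sup {enat k | k. \<exists>Zs. length Zs = Suc k \<and> hd Zs = Z \<and>
     (\<forall>Z' \<in> set Zs. irreducible_closed T Z') \<and> sorted_wrt (\<subset>) Zs}"

definition generic_point :: "'p topology \<Rightarrow> 'p set \<Rightarrow> 'p" where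
  "generic_point T Z = (THE z. z \<in> topspace T \<and> T closure_of {z} = Z)"

section \<open>Ringed spaces and schemes\<close>

record ('p, 'a) ringed_space =
  space_top :: "'p topology"
  sects :: "'p set \<Rightarrow> 'a ring"
  restr :: "'p set \<Rightarrow> 'p set \<Rightarrow> 'a \<Rightarrow> 'a"

abbreviation points :: "('p, 'a) ringed_space \<Rightarrow> 'p set" where
  "points \<XX> \<equiv> topspace (space_top \<XX>)"

abbreviation is_open :: "('p, 'a) ringed_space \<Rightarrow> 'p set \<Rightarrow> bool" where
  "is_open \<XX> U \<equiv> openin (space_top \<XX>) U"

definition sheaf_of_rings :: "('p, 'a) ringed_space \<Rightarrow> bool" where
  "sheaf_of_rings \<XX> \<longleftrightarrow>
     (\<forall>U. is_open \<XX> U \<longrightarrow> cring (sects \<XX> U)) \<and>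
     (\<forall>U V. is_open \<XX> U \<and> is_open \<XX> V \<and> V \<subseteq> U \<longrightarrow>
        restr \<XX> U V \<in> ring_hom (sects \<XX> U) (sects \<XX> V)) \<and>
     (\<forall>U. is_open \<XX> U \<longrightarrow> (\<forall>s \<in> carrier (sects \<XX> U). restr \<XX> U U s = s)) \<and>
     (\<forall>U V W. is_open \<XX> U \<and> is_open \<XX> V \<and> is_open \<XX> W \<and> V \<subseteq> U \<and> W \<subseteq> V \<longrightarrow>
        (\<forall>s \<in> carrier (sects \<XX> U). restr \<XX> V W (restr \<XX> U V s) = restr \<XX> U W s)) \<and>
     (\<forall>\<U> f. (\<forall>U \<in> \<U>. is_open \<XX> U \<and> f U \<in> carrier (sects \<XX> U)) \<and>
        (\<forall>U \<in> \<U>. \<forall>V \<in> \<U>. restr \<XX> U (U \<inter> V) (f U) = restr \<XX> V (U \<inter> V) (f V)) \<longrightarrow>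
        (\<exists>!s. s \<in> carrier (sects \<XX> (\<Union>\<U>)) \<and> (\<forall>U \<in> \<U>. restr \<XX> (\<Union>\<U>) U s = f U)))"

definition open_subspace :: "('p, 'a) ringed_space \<Rightarrow> 'p set \<Rightarrow> ('p, 'a) ringed_space" where
  "open_subspace \<XX> U = \<XX> \<lparr> space_top := subtopology (space_top \<XX>) U \<rparr>"

definition isomorphic_ringed_spaces ::
  "('p, 'a) ringed_space \<Rightarrow> ('q, 'b) ringed_space \<Rightarrow> bool" where
  "isomorphic_ringed_spaces \<XX> Y \<longleftrightarrow> (\<exists>f \<phi>. homeomorphic_map (space_top \<XX>) (space_top Y) f \<and>
     (\<forall>V. is_open Y V \<longrightarrow>
        \<phi> V \<in> ring_iso (sects Y V) (sects \<XX> {x \<in> points \<XX>. f x \<in> V})) \<and>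
     (\<forall>V W. is_open Y V \<and> is_open Y W \<and> W \<subseteq> V \<longrightarrow> (\<forall>s \<in> carrier (sects Y V).
        \<phi> W (restr Y V W s) =
        restr \<XX> {x \<in> points \<XX>. f x \<in> V} {x \<in> points \<XX>. f x \<in> W} (\<phi> V s))))"

definition germ :: "('p, 'a) ringed_space \<Rightarrow> 'p \<Rightarrow> 'p set \<Rightarrow> 'a \<Rightarrow> ('p set \<times> 'a) set" where
  "germ \<XX> x U s = {(V, t). is_open \<XX> V \<and> x \<in> V \<and> t \<in> carrier (sects \<XX> V) \<and>
     (\<exists>W. is_open \<XX> W \<and> x \<in> W \<and> W \<subseteq> U \<inter> V \<and> restr \<XX> U W s = restr \<XX> V W t)}"

definition stalk :: "('p, 'a) ringed_space \<Rightarrow> 'p \<Rightarrow> ('p set \<times> 'a) set ring" where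
  "stalk \<XX> x =
    \<lparr> carrier = {germ \<XX> x U s | U s. is_open \<XX> U \<and> x \<in> U \<and> s \<in> carrier (sects \<XX> U)},
      monoid.mult = (\<lambda>A B. \<Union>(U, s)\<in>A. \<Union>(V, t)\<in>B. germ \<XX> x (U \<inter> V)
        (restr \<XX> U (U \<inter> V) s \<otimes>\<^bsub>sects \<XX> (U \<inter> V)\<^esub> restr \<XX> V (U \<inter> V) t)),
      one = germ \<XX> x (points \<XX>) \<one>\<^bsub>sects \<XX> (points \<XX>)\<^esub>,
      ring.zero = germ \<XX> x (points \<XX>) \<zero>\<^bsub>sects \<XX> (points \<XX>)\<^esub>,
      add = (\<lambda>A B. \<Union>(U, s)\<in>A. \<Union>(V, t)\<in>B. germ \<XX> x (U \<inter> V)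
        (restr \<XX> U (U \<inter> V) s \<oplus>\<^bsub>sects \<XX> (U \<inter> V)\<^esub> restr \<XX> V (U \<inter> V) t)) \<rparr>"

text \<open>The maximal ideal of the stalk, which is a local ring on a scheme: its set of non-units.\<close>

definition stalk_max :: "('p, 'a) ringed_space \<Rightarrow> 'p \<Rightarrow> ('p set \<times> 'a) set set" where
  "stalk_max \<XX> x = carrier (stalk \<XX> x) - Units (stalk \<XX> x)"

definition residue_field :: "('p, 'a) ringed_space \<Rightarrow> 'p \<Rightarrow> ('p set \<times> 'a) set set ring" where
  "residue_field \<XX> x = stalk \<XX> x Quot stalk_max \<XX> x"

text \<open>Common construction of the structure sheaves of affine spectra and of \<open>\<XX> \<times> \<Delta>\<^sup>n\<close>. Each point \<open>y\<close>
  of \<open>T\<close> carries a ring \<open>B y\<close> with a prime ideal \<open>Q y\<close>, and \<open>F W\<close> is a set of families of elements of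
  the rings \<open>B y\<close>. Sections over \<open>V\<close> are functions with values in the localizations \<open>(B y)\<^bsub>Q y\<^esub>\<close> which
  are locally fractions of members of \<open>F\<close>.\<close>

definition fraction_space :: "'q topology \<Rightarrow> ('q \<Rightarrow> 'b ring) \<Rightarrow> ('q \<Rightarrow> 'b set) \<Rightarrow>
    ('q set \<Rightarrow> ('q \<Rightarrow> 'b) set) \<Rightarrow> ('q, 'q \<Rightarrow> ('b \<times> 'b) set) ringed_space" where
  "fraction_space T B Q F =
    \<lparr> space_top = T,
      sects = (\<lambda>V.
        \<lparr> carrier = {s \<in> extensional V. \<forall>y \<in> V. \<exists>W. openin T W \<and> y \<in> W \<and> W \<subseteq> V \<and>
            (\<exists>f \<in> F W. \<exists>g \<in> F W. \<forall>z \<in> W. g z \<notin> Q z \<and>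
               s z = fraction (B z) (Q z) (f z) (g z))},
          monoid.mult = (\<lambda>s t. \<lambda>y\<in>V. s y \<otimes>\<^bsub>localization (B y) (Q y)\<^esub> t y),
          one = (\<lambda>y\<in>V. \<one>\<^bsub>localization (B y) (Q y)\<^esub>),
          ring.zero = (\<lambda>y\<in>V. \<zero>\<^bsub>localization (B y) (Q y)\<^esub>),
          add = (\<lambda>s t. \<lambda>y\<in>V. s y \<oplus>\<^bsub>localization (B y) (Q y)\<^esub> t y) \<rparr>),
      restr = (\<lambda>U V s. restrict s V) \<rparr>"

definition Spec :: "'a ring \<Rightarrow> ('a set, 'a set \<Rightarrow> ('a \<times> 'a) set) ringed_space" where
  "Spec A = fraction_space
     (topology_generated_by {{P. primeideal P A \<and> f \<notin> P} | f. f \<in> carrier A})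
     (\<lambda>P. A) (\<lambda>P. P) (\<lambda>W. {(\<lambda>P. a) | a. a \<in> carrier A})"

definition affine_open :: "('p, 'a) ringed_space \<Rightarrow> 'p set \<Rightarrow> bool" where
  "affine_open \<XX> U \<longleftrightarrow>
     is_open \<XX> U \<and> isomorphic_ringed_spaces (open_subspace \<XX> U) (Spec (sects \<XX> U))"

definition scheme :: "('p, 'a) ringed_space \<Rightarrow> bool" where
  "scheme \<XX> \<longleftrightarrow> sheaf_of_rings \<XX> \<and> (\<forall>x \<in> points \<XX>. \<exists>U. affine_open \<XX> U \<and> x \<in> U)"

definition finite_type_scheme :: "('p, 'a) ringed_space \<Rightarrow> bool" where
  "finite_type_scheme \<XX> \<longleftrightarrow> scheme \<XX> \<and> compact_space (space_top \<XX>) \<and>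
     (\<forall>x \<in> points \<XX>. \<exists>U. affine_open \<XX> U \<and> x \<in> U \<and> finitely_generated_ring (sects \<XX> U))"

section \<open>The zeta function\<close>

definition closed_points :: "('p, 'a) ringed_space \<Rightarrow> 'p set" where
  "closed_points \<XX> = {x \<in> points \<XX>. closedin (space_top \<XX>) {x}}"

definition point_norm :: "('p, 'a) ringed_space \<Rightarrow> 'p \<Rightarrow> nat" where
  "point_norm \<XX> x = card (carrier (residue_field \<XX> x))"

text \<open>\<open>\<zeta>\<close> is the zeta function of \<open>\<XX>\<close>, meromorphic at \<open>s0\<close>: the (unconditionally convergent) Euler
  product in some right half plane, continued meromorphically to a connected open set containing
  this half plane and \<open>s0\<close>.\<close>

definition zeta_meromorphic_at :: "('p, 'a) ringed_space \<Rightarrow> (complex \<Rightarrow> complex) \<Rightarrow> complex \<Rightarrow> bool"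
  where
  "zeta_meromorphic_at \<XX> \<zeta> s0 \<longleftrightarrow> (\<exists>D c. open D \<and> connected D \<and> s0 \<in> D \<and> {s. Re s > c} \<subseteq> D \<and>
     \<zeta> meromorphic_on D \<and>
     (\<forall>s. Re s > c \<longrightarrow>
        ((\<lambda>F. \<Prod>x\<in>F. inverse (1 - of_nat (point_norm \<XX> x) powr (- s))) \<longlongrightarrow> \<zeta> s)
          (finite_subsets_at_top (closed_points \<XX>))))"

section \<open>The schemes \<open>\<XX> \<times> \<Delta>\<^sup>n\<close>\<close>

text \<open>\<open>A[\<Delta>\<^sup>n] = A[t\<^sub>0, \<dots>, t\<^sub>n] / (t\<^sub>0 + \<dots> + t\<^sub>n - 1)\<close>.\<close>

definition simplex_ideal :: "'a ring \<Rightarrow> nat \<Rightarrow> (nat multiset \<Rightarrow> 'a) set" where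
  "simplex_ideal A n = (let P = mpoly_ring A {..n} in
     genideal P {finsum P (ring.indexed_var A) {..n} \<ominus>\<^bsub>P\<^esub> \<one>\<^bsub>P\<^esub>})"

definition simplex_algebra :: "'a ring \<Rightarrow> nat \<Rightarrow> (nat multiset \<Rightarrow> 'a) set ring" where
  "simplex_algebra A n = mpoly_ring A {..n} Quot simplex_ideal A n"

definition simplex_class ::
    "'a ring \<Rightarrow> nat \<Rightarrow> (nat multiset \<Rightarrow> 'a) \<Rightarrow> (nat multiset \<Rightarrow> 'a) set" where
  "simplex_class A n p = simplex_ideal A n +>\<^bsub>mpoly_ring A {..n}\<^esub> p"

text \<open>A map \<open>\<theta> : {0..m} \<rightarrow> {0..n}\<close> of vertices induces \<open>A[\<Delta>\<^sup>n] \<rightarrow> A[\<Delta>\<^sup>m]\<close>, sending \<open>t\<^sub>i\<close> to the sum of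
  the \<open>t\<^sub>j\<close> with \<open>\<theta> j = i\<close>. Here this is the substitution on representing polynomials.\<close>

definition simplex_subst :: "'a ring \<Rightarrow> nat \<Rightarrow> nat \<Rightarrow> (nat \<Rightarrow> nat) \<Rightarrow>
    (nat multiset \<Rightarrow> 'a) \<Rightarrow> (nat multiset \<Rightarrow> 'a)" where
  "simplex_subst A m n \<theta> p = (let P = mpoly_ring A {..m} in
     finsum P (\<lambda>\<mu>. ring.indexed_const A (p \<mu>) \<otimes>\<^bsub>P\<^esub>
         finprod P (\<lambda>i. finsum P (ring.indexed_var A) {j \<in> {..m}. \<theta> j = i} [^]\<^bsub>P\<^esub> count \<mu> i) {..n})
       {\<mu>. p \<mu> \<noteq> \<zero>\<^bsub>A\<^esub>})"

type_synonym ('p, 'a) simplex_elem = "(nat multiset \<Rightarrow> ('p set \<times> 'a) set) set"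
type_synonym ('p, 'a) simplex_point = "'p \<times> ('p, 'a) simplex_elem set"

text \<open>The points of \<open>\<XX> \<times> \<Delta>\<^sup>n\<close> over \<open>x\<close>, that is, the primes of \<open>\<kappa>(x)[\<Delta>\<^sup>n]\<close>, are the primes of
  \<open>\<O>\<^bsub>\<XX>,x\<^esub>[\<Delta>\<^sup>n]\<close> lying over the maximal ideal.\<close>

definition simplex_points :: "('p, 'a) ringed_space \<Rightarrow> nat \<Rightarrow> ('p, 'a) simplex_point set" where
  "simplex_points \<XX> n = {(x, Q). x \<in> points \<XX> \<and> primeideal Q (simplex_algebra (stalk \<XX> x) n) \<and>
     {a \<in> carrier (stalk \<XX> x).
        simplex_class (stalk \<XX> x) n (ring.indexed_const (stalk \<XX> x) a) \<in> Q} = stalk_max \<XX> x}"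

text \<open>The family of elements of the rings \<open>\<O>\<^bsub>\<XX>,x\<^esub>[\<Delta>\<^sup>n]\<close>, \<open>x \<in> U\<close>, given by \<open>f \<in> \<O>\<^sub>\<XX>(U)[t\<^sub>0, \<dots>, t\<^sub>n]\<close>.\<close>

definition simplex_family :: "('p, 'a) ringed_space \<Rightarrow> nat \<Rightarrow> 'p set \<Rightarrow> (nat multiset \<Rightarrow> 'a) \<Rightarrow>
    ('p, 'a) simplex_point \<Rightarrow> ('p, 'a) simplex_elem" where
  "simplex_family \<XX> n U f y = simplex_class (stalk \<XX> (fst y)) n (\<lambda>\<mu>. germ \<XX> (fst y) U (f \<mu>))"

text \<open>\<open>\<XX> \<times> \<Delta>\<^sup>n\<close>, as the relative spectrum of \<open>\<O>\<^sub>\<XX>[\<Delta>\<^sup>n]\<close>.\<close>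

definition times_simplex :: "('p, 'a) ringed_space \<Rightarrow> nat \<Rightarrow>
    (('p, 'a) simplex_point,
     ('p, 'a) simplex_point \<Rightarrow> (('p, 'a) simplex_elem \<times> ('p, 'a) simplex_elem) set) ringed_space"
  where
  "times_simplex \<XX> n = fraction_space
     (topology_generated_by
        {{y \<in> simplex_points \<XX> n. fst y \<in> U \<and> simplex_family \<XX> n U f y \<notin> snd y} | U f.
           is_open \<XX> U \<and> f \<in> carrier (mpoly_ring (sects \<XX> U) {..n})})
     (\<lambda>y. simplex_algebra (stalk \<XX> (fst y)) n) snd
     (\<lambda>W. {simplex_family \<XX> n U f | U f.
        is_open \<XX> U \<and> fst ` W \<subseteq> U \<and> f \<in> carrier (mpoly_ring (sects \<XX> U) {..n})})"

definition simplex_coord :: "('p, 'a) ringed_space \<Rightarrow> nat \<Rightarrow> nat \<Rightarrow> ('p, 'a) simplex_point \<Rightarrow>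
    (('p, 'a) simplex_elem \<times> ('p, 'a) simplex_elem) set" where
  "simplex_coord \<XX> n i = (\<lambda>y \<in> points (times_simplex \<XX> n).
     fraction (simplex_algebra (stalk \<XX> (fst y)) n) (snd y)
       (simplex_class (stalk \<XX> (fst y)) n (ring.indexed_var (stalk \<XX> (fst y)) i))
       \<one>\<^bsub>simplex_algebra (stalk \<XX> (fst y)) n\<^esub>)"

text \<open>The face \<open>\<XX> \<times> {t\<^sub>i = 0 for i \<in> I}\<close>.\<close>

definition simplex_face :: "('p, 'a) ringed_space \<Rightarrow> nat \<Rightarrow> nat set \<Rightarrow> ('p, 'a) simplex_point set" where
  "simplex_face \<XX> n I = {y \<in> points (times_simplex \<XX> n). \<forall>i \<in> I.
     simplex_class (stalk \<XX> (fst y)) n (ring.indexed_var (stalk \<XX> (fst y)) i) \<in> snd y}"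

text \<open>The morphism \<open>\<XX> \<times> \<Delta>\<^sup>m \<rightarrow> \<XX> \<times> \<Delta>\<^sup>n\<close> (on points) induced by \<open>\<theta> : {0..m} \<rightarrow> {0..n}\<close>, and preimages
  under it.\<close>

definition simplex_map :: "('p, 'a) ringed_space \<Rightarrow> nat \<Rightarrow> nat \<Rightarrow> (nat \<Rightarrow> nat) \<Rightarrow>
    ('p, 'a) simplex_point \<Rightarrow> ('p, 'a) simplex_point" where
  "simplex_map \<XX> m n \<theta> y = (let A = stalk \<XX> (fst y) in
     (fst y, {c \<in> carrier (simplex_algebra A n).
                \<forall>p \<in> c. simplex_class A m (simplex_subst A m n \<theta> p) \<in> snd y}))"

definition simplex_preimage :: "('p, 'a) ringed_space \<Rightarrow> nat \<Rightarrow> nat \<Rightarrow> (nat \<Rightarrow> nat) \<Rightarrow>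
    ('p, 'a) simplex_point set \<Rightarrow> ('p, 'a) simplex_point set" where
  "simplex_preimage \<XX> m n \<theta> Z = {y \<in> points (times_simplex \<XX> m). simplex_map \<XX> m n \<theta> y \<in> Z}"

section \<open>Bloch's cycle groups\<close>

text \<open>An integral closed subscheme is represented by its underlying irreducible closed subset.\<close>

definition meets_faces_properly ::
    "('p, 'a) ringed_space \<Rightarrow> int \<Rightarrow> nat \<Rightarrow> ('p, 'a) simplex_point set \<Rightarrow> bool" where
  "meets_faces_properly \<XX> r n Z \<longleftrightarrow> (\<forall>I. I \<subset> {..n} \<longrightarrow>
     (\<forall>W \<in> irreducible_components (space_top (times_simplex \<XX> n)) (Z \<inter> simplex_face \<XX> n I).
        enat (nat r) \<le> codim (subtopology (space_top (times_simplex \<XX> n)) (simplex_face \<XX> n I)) W))"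

definition admissible_subvarieties ::
    "('p, 'a) ringed_space \<Rightarrow> int \<Rightarrow> nat \<Rightarrow> ('p, 'a) simplex_point set set" where
  "admissible_subvarieties \<XX> r n = {Z. irreducible_closed (space_top (times_simplex \<XX> n)) Z \<and>
     0 \<le> r \<and> codim (space_top (times_simplex \<XX> n)) Z = enat (nat r) \<and> meets_faces_properly \<XX> r n Z}"

type_synonym ('p, 'a) cycle = "('p, 'a) simplex_point set \<Rightarrow>\<^sub>0 int"

definition cycle_group :: "('p, 'a) ringed_space \<Rightarrow> int \<Rightarrow> nat \<Rightarrow> ('p, 'a) cycle monoid" where
  "cycle_group \<XX> r n = free_Abelian_group (admissible_subvarieties \<XX> r n)"

text \<open>The ideal of the closed subset \<open>Z\<close> (with its reduced structure) in the local ring at \<open>w\<close>.\<close>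

definition vanishing_ideal ::
    "('p, 'a) ringed_space \<Rightarrow> 'p set \<Rightarrow> 'p \<Rightarrow> ('p set \<times> 'a) set set" where
  "vanishing_ideal Y Z w = {germ Y w V s | V s. is_open Y V \<and> w \<in> V \<and> s \<in> carrier (sects Y V) \<and>
     (\<forall>z \<in> V \<inter> Z. germ Y z V s \<in> stalk_max Y z)}"

text \<open>Intersection multiplicity of \<open>Z\<close> with the Cartier divisor \<open>t\<^sub>i = 0\<close> along a component \<open>W\<close>: the
  length of \<open>\<O>\<^bsub>Z,W\<^esub> / (t\<^sub>i)\<close>.\<close>

definition face_multiplicity :: "('p, 'a) ringed_space \<Rightarrow> nat \<Rightarrow> nat \<Rightarrow>
    ('p, 'a) simplex_point set \<Rightarrow> ('p, 'a) simplex_point set \<Rightarrow> nat" where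
  "face_multiplicity \<XX> n i Z W =
     (let Y = times_simplex \<XX> n; w = generic_point (space_top Y) W; R = stalk Y w in
      the_enat (ring_length (R Quot genideal R
        (vanishing_ideal Y Z w \<union> {germ Y w (points Y) (simplex_coord \<XX> n i)}))))"

text \<open>Pullback of cycles along the \<open>i\<close>-th face \<open>\<XX> \<times> \<Delta>\<^bsup>n-1\<^esup> \<rightarrow> \<XX> \<times> \<Delta>\<^sup>n\<close>.\<close>

definition cycle_face :: "('p, 'a) ringed_space \<Rightarrow> nat \<Rightarrow> nat \<Rightarrow> ('p, 'a) cycle \<Rightarrow> ('p, 'a) cycle" where
  "cycle_face \<XX> n i = frag_extend (\<lambda>Z.
     \<Sum>W \<in> irreducible_components (space_top (times_simplex \<XX> n)) (Z \<inter> simplex_face \<XX> n {i}).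
       frag_cmul (int (face_multiplicity \<XX> n i Z W))
         (frag_of (simplex_preimage \<XX> (n - 1) n (\<lambda>j. if j < i then j else Suc j) W)))"

text \<open>Pullback along the cyclic permutation of the vertices of \<open>\<Delta>\<^sup>n\<close>, and along the last degeneracy
  \<open>\<XX> \<times> \<Delta>\<^bsup>n+1\<^esup> \<rightarrow> \<XX> \<times> \<Delta>\<^sup>n\<close>. The latter is a bundle of affine lines, so preimages of integral closed
  subschemes are integral.\<close>

definition cycle_cyclic :: "('p, 'a) ringed_space \<Rightarrow> nat \<Rightarrow> ('p, 'a) cycle \<Rightarrow> ('p, 'a) cycle" where
  "cycle_cyclic \<XX> n = frag_extend (\<lambda>Z.
     frag_of (simplex_preimage \<XX> n n (\<lambda>j. if j = 0 then n else j - 1) Z))"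

definition cycle_degeneracy :: "('p, 'a) ringed_space \<Rightarrow> nat \<Rightarrow> ('p, 'a) cycle \<Rightarrow> ('p, 'a) cycle" where
  "cycle_degeneracy \<XX> n = frag_extend (\<lambda>Z.
     frag_of (simplex_preimage \<XX> (Suc n) n (\<lambda>j. min j n) Z))"

section \<open>Precyclic abelian groups and their homology\<close>

text \<open>Abelian groups are written multiplicatively, as usual in HOL-Algebra.\<close>

locale precyclic_last_degeneracy =
  fixes C :: "nat \<Rightarrow> 'c monoid"
    and d :: "nat \<Rightarrow> nat \<Rightarrow> 'c \<Rightarrow> 'c"
    and T :: "nat \<Rightarrow> 'c \<Rightarrow> 'c"
    and s :: "nat \<Rightarrow> 'c \<Rightarrow> 'c"
  assumes comm_group: "comm_group (C n)"
    and d_hom: "1 \<le> n \<Longrightarrow> i \<le> n \<Longrightarrow> d n i \<in> hom (C n) (C (n - 1))"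
    and T_hom: "T n \<in> hom (C n) (C n)"
    and s_hom: "s n \<in> hom (C n) (C (Suc n))"
    and d_d: "2 \<le> n \<Longrightarrow> i < j \<Longrightarrow> j \<le> n \<Longrightarrow> x \<in> carrier (C n) \<Longrightarrow>
               d (n - 1) i (d n j x) = d (n - 1) (j - 1) (d n i x)"
    and T_pow: "x \<in> carrier (C n) \<Longrightarrow> (T n ^^ Suc n) x = x"
    and d_0_T: "1 \<le> n \<Longrightarrow> x \<in> carrier (C n) \<Longrightarrow> d n 0 (T n x) = d n n x"
    and d_T: "1 \<le> i \<Longrightarrow> i \<le> n \<Longrightarrow> x \<in> carrier (C n) \<Longrightarrow>
               d n i (T n x) = T (n - 1) (d n (i - 1) x)"
    and d_s: "1 \<le> n \<Longrightarrow> i \<le> n - 1 \<Longrightarrow> x \<in> carrier (C n) \<Longrightarrow>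
               d (Suc n) i (s n x) = s (n - 1) (d n i x)"
    and d_n_s: "x \<in> carrier (C n) \<Longrightarrow> d (Suc n) n (s n x) = x"
    and d_Suc_n_s: "x \<in> carrier (C n) \<Longrightarrow> d (Suc n) (Suc n) (s n x) = x"

text \<open>The boundaries \<open>\<partial>\<close> and \<open>\<partial>'\<close>; only used for \<open>n \<ge> 1\<close>.\<close>

definition bdry :: "(nat \<Rightarrow> 'c monoid) \<Rightarrow> (nat \<Rightarrow> nat \<Rightarrow> 'c \<Rightarrow> 'c) \<Rightarrow> nat \<Rightarrow> 'c \<Rightarrow> 'c" where
  "bdry C d n x = finprod (C (n - 1)) (\<lambda>i. d n i x [^]\<^bsub>C (n - 1)\<^esub> ((-1) ^ i :: int)) {..n}"

definition bdry' :: "(nat \<Rightarrow> 'c monoid) \<Rightarrow> (nat \<Rightarrow> nat \<Rightarrow> 'c \<Rightarrow> 'c) \<Rightarrow> nat \<Rightarrow> 'c \<Rightarrow> 'c" where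
  "bdry' C d n x = finprod (C (n - 1)) (\<lambda>i. d n i x [^]\<^bsub>C (n - 1)\<^esub> ((-1) ^ i :: int)) {..<n}"

definition signed_cyclic :: "(nat \<Rightarrow> 'c monoid) \<Rightarrow> (nat \<Rightarrow> 'c \<Rightarrow> 'c) \<Rightarrow> nat \<Rightarrow> 'c \<Rightarrow> 'c" where
  "signed_cyclic C T n x = T n x [^]\<^bsub>C n\<^esub> ((-1) ^ n :: int)"

definition cyclic_norm :: "(nat \<Rightarrow> 'c monoid) \<Rightarrow> (nat \<Rightarrow> 'c \<Rightarrow> 'c) \<Rightarrow> nat \<Rightarrow> 'c \<Rightarrow> 'c" where
  "cyclic_norm C T n x = finprod (C n) (\<lambda>k. (signed_cyclic C T n ^^ k) x) {..n}"

text \<open>Homology of a chain complex \<open>\<dots> \<rightarrow> C 1 \<rightarrow> C 0 \<rightarrow> 0\<close>, with \<open>D n : C n \<rightarrow> C (n - 1)\<close> for \<open>n \<ge> 1\<close>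
  and trivial groups in negative degrees.\<close>

definition homology :: "(nat \<Rightarrow> 'c monoid) \<Rightarrow> (nat \<Rightarrow> 'c \<Rightarrow> 'c) \<Rightarrow> int \<Rightarrow> 'c set monoid" where
  "homology C D k = (if k < 0 then singleton_group undefined else let n = nat k in
     subgroup_generated (C n) (if n = 0 then carrier (C n) else kernel (C n) (C (n - 1)) (D n))
       Mod (D (Suc n) ` carrier (C (Suc n))))"

text \<open>The differentials of the cyclic bicomplex \<open>CC\<^bsub>a,m\<^esub> = C m\<close> starting at \<open>CC\<^bsub>a,m\<^esub>\<close>, for \<open>m \<ge> 1\<close>
  and \<open>a \<ge> 1\<close> respectively.\<close>

definition cc_vertical ::
    "(nat \<Rightarrow> 'c monoid) \<Rightarrow> (nat \<Rightarrow> nat \<Rightarrow> 'c \<Rightarrow> 'c) \<Rightarrow> nat \<Rightarrow> nat \<Rightarrow> 'c \<Rightarrow> 'c" where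
  "cc_vertical C d a m x = (if even a then bdry C d m x else inv\<^bsub>C (m - 1)\<^esub> (bdry' C d m x))"

definition cc_horizontal ::
    "(nat \<Rightarrow> 'c monoid) \<Rightarrow> (nat \<Rightarrow> 'c \<Rightarrow> 'c) \<Rightarrow> nat \<Rightarrow> nat \<Rightarrow> 'c \<Rightarrow> 'c" where
  "cc_horizontal C T a m x =
     (if odd a then x \<otimes>\<^bsub>C m\<^esub> inv\<^bsub>C m\<^esub> (signed_cyclic C T m x) else cyclic_norm C T m x)"

text \<open>The component of an element of the total complex at index \<open>a\<close> lies in column \<open>a\<close>.\<close>

definition cc_total :: "(nat \<Rightarrow> 'c monoid) \<Rightarrow> nat \<Rightarrow> (nat \<Rightarrow> 'c) monoid" where
  "cc_total C n = product_group {..n} (\<lambda>a. C (n - a))"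

definition cc_differential :: "(nat \<Rightarrow> 'c monoid) \<Rightarrow> (nat \<Rightarrow> nat \<Rightarrow> 'c \<Rightarrow> 'c) \<Rightarrow> (nat \<Rightarrow> 'c \<Rightarrow> 'c) \<Rightarrow>
    nat \<Rightarrow> (nat \<Rightarrow> 'c) \<Rightarrow> (nat \<Rightarrow> 'c)" where
  "cc_differential C d T n x = (\<lambda>a\<in>{..n - 1}.
     cc_vertical C d a (n - a) (x a) \<otimes>\<^bsub>C (n - 1 - a)\<^esub>
     cc_horizontal C T (Suc a) (n - 1 - a) (x (Suc a)))"

section \<open>Higher Chow groups and their cyclic version\<close>

definition CH_can_be_defined :: "('p, 'a) ringed_space \<Rightarrow> int \<Rightarrow> bool" where
  "CH_can_be_defined \<XX> r \<longleftrightarrow> precyclic_last_degeneracy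
     (cycle_group \<XX> r) (cycle_face \<XX>) (cycle_cyclic \<XX>) (cycle_degeneracy \<XX>)"

definition CH :: "('p, 'a) ringed_space \<Rightarrow> int \<Rightarrow> int \<Rightarrow> ('p, 'a) cycle set monoid" where
  "CH \<XX> r = homology (cycle_group \<XX> r) (bdry (cycle_group \<XX> r) (cycle_face \<XX>))"

definition CHC :: "('p, 'a) ringed_space \<Rightarrow> int \<Rightarrow> int \<Rightarrow> (nat \<Rightarrow> ('p, 'a) cycle) set monoid" where
  "CHC \<XX> r = homology (cc_total (cycle_group \<XX> r))
     (cc_differential (cycle_group \<XX> r) (cycle_face \<XX>) (cycle_cyclic \<XX>))"

section \<open>Ranks of abelian groups\<close>

definition int_independent :: "'g monoid \<Rightarrow> 'g set \<Rightarrow> bool" where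
  "int_independent G S \<longleftrightarrow> (\<forall>c :: 'g \<Rightarrow> int.
     finprod G (\<lambda>x. x [^]\<^bsub>G\<^esub> c x) S = \<one>\<^bsub>G\<^esub> \<longrightarrow> (\<forall>x \<in> S. c x = 0))"

definition group_rank :: "'g monoid \<Rightarrow> enat" where
  "group_rank G = Sup {enat (card S) | S. finite S \<and> S \<subseteq> carrier G \<and> int_independent G S}"

definition finite_rank :: "'g monoid \<Rightarrow> bool" where
  "finite_rank G \<longleftrightarrow> group_rank G \<noteq> \<infinity>"

text \<open>Only meaningful for groups of finite rank.\<close>

definition rk :: "'g monoid \<Rightarrow> nat" where
  "rk G = the_enat (group_rank G)"

end

theory Submission
  imports Defs "HOL-Library.Function_Algebras"
begin

text \<open>The statement is about the precyclic group only. The last degeneracy contracts the odd columns of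
  the cyclic bicomplex, so its first two columns compute \<open>CH\<close>, and the quotient of the total complex
  by them is the total complex shifted by two. Hence there is a long exact sequence
  \<open>CH\<^sub>n \<rightarrow> CHC\<^sub>n \<rightarrow> CHC\<^bsub>n-2\<^esub> \<rightarrow> CH\<^bsub>n-1\<^esub>\<close>. If \<open>i\<^sub>n\<close> is the rank of the image of \<open>CHC\<^sub>n \<rightarrow> CHC\<^bsub>n-2\<^esub>\<close>,
  the alternating sum of the ranks of \<open>CH\<^sub>0, \<dots>, CH\<^sub>m\<close> telescopes to \<open>(-1)\<^sup>m (rk CHC\<^sub>m - i\<^bsub>m+1\<^esub>)\<close>, and
  \<open>i\<^bsub>m+1\<^esub> = rk CHC\<^bsub>m+1\<^esub>\<close> once \<open>rk CH\<^bsub>m+1\<^esub> = 0\<close>.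

  The chain groups have infinite rank, so Euler characteristics have to be taken on homology. Ranks of
  subquotients \<open>Z/B\<close> are handled as maximal sizes of families in \<open>Z\<close> that are independent modulo \<open>B\<close>,
  inside one fixed module; this avoids quotient types and, as free abelian groups live in an
  additive type, the multiplicative notation.\<close>

section \<open>Relative ranks of modules over an integral domain\<close>

lemma enat_leI:
  fixes x y :: enat
  assumes "\<And>n. enat n \<le> x \<Longrightarrow> enat n \<le> y"
  shows "x \<le> y"
proof (cases x)
  case (enat m)
  then show ?thesis using assms[of m] by simp
next
  case infinity
  show ?thesis
  proof (cases y)
    case (enat m)
    have "enat (Suc m) \<le> y" by (rule assms) (simp add: infinity)
    then show ?thesis using enat by simp
  qed simp
qed

lemma enat_eqI:
  fixes x y :: enat
  assumes "\<And>n. enat n \<le> x \<longleftrightarrow> enat n \<le> y"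
  shows "x = y"
  by (rule antisym; rule enat_leI) (simp_all only: assms)

text \<open>If \<open>P n\<close> fails, downward closure keeps every \<open>k\<close> with
  \<open>P k\<close> below \<open>n\<close>. So a finite lower bound of a supremum of attained sizes
  always has a witness, and identities between possibly infinite ranks reduce to finite
  families.\<close>

lemma enat_le_Sup_iff:
  assumes "P 0" and "\<And>m n. m \<le> n \<Longrightarrow> P n \<Longrightarrow> P m"
  shows "enat n \<le> Sup {enat k | k. P k} \<longleftrightarrow> P n"
proof
  assume le: "enat n \<le> Sup {enat k | k. P k}"
  show "P n"
  proof (rule ccontr)
    assume "\<not> P n"
    then obtain m where m: "n = Suc m" using assms(1) by (cases n) auto
    have "k \<le> m" if "P k" for k
      using assms(2)[of n k] that \<open>\<not> P n\<close> m by (metis not_less_eq_eq)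
    then have "Sup {enat k | k. P k} \<le> enat m" by (intro Sup_least) auto
    then have "enat n \<le> enat m" by (rule order_trans[OF le])
    then show False using m by simp
  qed
qed (auto intro: Sup_upper)

lemma enat_le_add_iff:
  fixes x y :: enat
  shows "enat n \<le> x + y \<longleftrightarrow> (\<exists>p q. n = p + q \<and> enat p \<le> x \<and> enat q \<le> y)"
proof
  assume le: "enat n \<le> x + y"
  show "\<exists>p q. n = p + q \<and> enat p \<le> x \<and> enat q \<le> y"
  proof (cases "enat n \<le> x")
    case True
    then show ?thesis by (intro exI[of _ n] exI[of _ 0]) (auto simp: zero_enat_def[symmetric])
  next
    case False
    then obtain p where p: "x = enat p" "p < n" by (cases x) auto
    then have "enat (n - p) \<le> y" using le by (cases y) auto
    then show ?thesis using p by (intro exI[of _ p] exI[of _ "n - p"]) auto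
  qed
next
  assume "\<exists>p q. n = p + q \<and> enat p \<le> x \<and> enat q \<le> y"
  then show "enat n \<le> x + y"
    by (metis add_mono plus_enat_simps(1))
qed

locale domain_module = Modules.module scale
  for scale :: "'r::idom \<Rightarrow> 'b::ab_group_add \<Rightarrow> 'b" (infixr \<open>\<star>\<close> 75)
begin

lemma subspace_set_plus:
  assumes A: "subspace A" and B: "subspace B"
  shows "subspace {a + b | a b. a \<in> A \<and> b \<in> B}"
proof (rule subspaceI)
  show "0 \<in> {a + b | a b. a \<in> A \<and> b \<in> B}"
    using subspace_0[OF A] subspace_0[OF B] by force
  show "x + y \<in> {a + b | a b. a \<in> A \<and> b \<in> B}"
    if "x \<in> {a + b | a b. a \<in> A \<and> b \<in> B}" "y \<in> {a + b | a b. a \<in> A \<and> b \<in> B}" for x y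
  proof -
    from that obtain a b a' b' where eq: "x = a + b" "y = a' + b'"
      and mem: "a \<in> A" "b \<in> B" "a' \<in> A" "b' \<in> B" by blast
    have "x + y = (a + a') + (b + b')" using eq by (simp add: algebra_simps)
    then show ?thesis using mem subspace_add[OF A] subspace_add[OF B] by blast
  qed
  show "c \<star> x \<in> {a + b | a b. a \<in> A \<and> b \<in> B}" if "x \<in> {a + b | a b. a \<in> A \<and> b \<in> B}" for c x
  proof -
    from that obtain a b where eq: "x = a + b" and mem: "a \<in> A" "b \<in> B" by blast
    have "c \<star> x = c \<star> a + c \<star> b" using eq by (simp add: scale_right_distrib)
    then show ?thesis using mem subspace_scale[OF A] subspace_scale[OF B] by blast
  qed
qed

text \<open>Linear independence of the classes modulo \<open>B\<close>, without forming the
  quotient. Indexed families can be concatenated and transported along maps with no care for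
  repetitions.\<close>

definition indep_mod :: "'b set \<Rightarrow> 'i set \<Rightarrow> ('i \<Rightarrow> 'b) \<Rightarrow> bool" where
  "indep_mod B I z \<longleftrightarrow> (\<forall>c. (\<Sum>i\<in>I. c i \<star> z i) \<in> B \<longrightarrow> (\<forall>i\<in>I. c i = 0))"

lemma indep_mod_empty [simp]: "indep_mod B {} z"
  by (simp add: indep_mod_def)

lemma indep_mod_subset:
  assumes "indep_mod B I z" "J \<subseteq> I" "finite I"
  shows "indep_mod B J z"
  unfolding indep_mod_def
proof (intro allI impI)
  fix c assume c: "(\<Sum>i\<in>J. c i \<star> z i) \<in> B"
  let ?c = "\<lambda>i. if i \<in> J then c i else 0"
  have "(\<Sum>i\<in>I. ?c i \<star> z i) = (\<Sum>i\<in>J. c i \<star> z i)"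
    using assms(2,3) by (intro sum.mono_neutral_cong_right) auto
  then have "\<forall>i\<in>I. ?c i = 0"
    using assms(1)[unfolded indep_mod_def, rule_format, of ?c] c by simp
  then show "\<forall>i\<in>J. c i = 0" using assms(2) by (metis subset_iff)
qed

lemma indep_mod_reindex:
  assumes "bij_betw h I J" "indep_mod B J z"
  shows "indep_mod B I (z \<circ> h)"
  unfolding indep_mod_def
proof (intro allI impI)
  fix c assume c: "(\<Sum>i\<in>I. c i \<star> (z \<circ> h) i) \<in> B"
  have "(\<Sum>j\<in>J. c (inv_into I h j) \<star> z j) = (\<Sum>i\<in>I. c i \<star> (z \<circ> h) i)"
    using assms(1) sum.reindex_bij_betw[OF assms(1), of "\<lambda>j. c (inv_into I h j) \<star> z j"]
    by (simp add: bij_betw_inv_into_left cong: sum.cong)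
  then have "\<forall>j\<in>J. c (inv_into I h j) = 0"
    using assms(2)[unfolded indep_mod_def, rule_format, of "\<lambda>j. c (inv_into I h j)"] c by simp
  then show "\<forall>i\<in>I. c i = 0"
    using assms(1) by (metis bij_betw_apply bij_betw_inv_into_left)
qed

text \<open>The rank of the quotient module \<open>Z/B\<close>.\<close>

definition rel_rank :: "'b set \<Rightarrow> 'b set \<Rightarrow> enat" where
  "rel_rank Z B = Sup {enat n | n. \<exists>z. (\<forall>i<n. z i \<in> Z) \<and> indep_mod B {..<n} z}"

lemma enat_le_rel_rank_iff:
  "enat n \<le> rel_rank Z B \<longleftrightarrow> (\<exists>z. (\<forall>i<n. z i \<in> Z) \<and> indep_mod B {..<n} z)"
  unfolding rel_rank_def
proof (rule enat_le_Sup_iff)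
  show "\<exists>z. (\<forall>i<m. z i \<in> Z) \<and> indep_mod B {..<m} z"
    if "m \<le> n" "\<exists>z. (\<forall>i<n. z i \<in> Z) \<and> indep_mod B {..<n} z" for m n :: nat
  proof -
    from that(2) obtain z where "\<forall>i<n. z i \<in> Z" "indep_mod B {..<n} z" by blast
    then have "(\<forall>i<m. z i \<in> Z) \<and> indep_mod B {..<m} z"
      using indep_mod_subset[of B "{..<n}" z "{..<m}"] that(1) by auto
    then show ?thesis by blast
  qed
qed simp

lemma card_le_rel_rank:
  assumes "finite I" "\<And>i. i \<in> I \<Longrightarrow> z i \<in> Z" "indep_mod B I z"
  shows "enat (card I) \<le> rel_rank Z B"
proof -
  obtain h where h: "bij_betw h {..<card I} I"
    using assms(1) ex_bij_betw_nat_finite atLeast0LessThan by metis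
  then have "\<forall>i<card I. (z \<circ> h) i \<in> Z"
    using assms(2) by (auto dest: bij_betw_apply)
  then show ?thesis
    unfolding enat_le_rel_rank_iff using indep_mod_reindex[OF h assms(3)]
    by (intro exI[of _ "z \<circ> h"] conjI)
qed

lemma rel_rank_eq_0:
  assumes "Z \<subseteq> B"
  shows "rel_rank Z B = 0"
proof (rule ccontr)
  assume "rel_rank Z B \<noteq> 0"
  then have "enat 1 \<le> rel_rank Z B"
    by (cases "rel_rank Z B") (auto simp: zero_enat_def)
  then obtain z where "z 0 \<in> Z" "indep_mod B {..<1::nat} z"
    unfolding enat_le_rel_rank_iff by auto
  then show False
    using assms by (auto simp: indep_mod_def dest!: spec[of _ "\<lambda>_. 1"])
qed

text \<open>Additivity of the rank for Z/B, Y/B and Y/Z, infinite ranks included. A family in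
  \<open>Y\<close> independent modulo \<open>B\<close> splits into a maximal subfamily independent
  modulo \<open>Z\<close> and, for each remaining index, a combination lying in
  \<open>Z\<close>.\<close>

lemma rel_rank_chain:
  assumes "subspace B" "subspace Z" "subspace Y" "B \<subseteq> Z" "Z \<subseteq> Y"
  shows "rel_rank Y B = rel_rank Y Z + rel_rank Z B"
proof (rule enat_eqI)
  fix n
  show "enat n \<le> rel_rank Y B \<longleftrightarrow> enat n \<le> rel_rank Y Z + rel_rank Z B"
  proof
    assume "enat n \<le> rel_rank Y B"
    then obtain x where x: "\<And>i. i < n \<Longrightarrow> x i \<in> Y" and indep: "indep_mod B {..<n} x"
      unfolding enat_le_rel_rank_iff by blast
    let ?P = "\<lambda>T. T \<subseteq> {..<n} \<and> indep_mod Z T x"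
    have "finite {T. ?P T}" by (rule finite_subset[of _ "Pow {..<n}"]) auto
    moreover have "{T. ?P T} \<noteq> {}" by (auto intro: exI[of _ "{}"])
    ultimately have "\<exists>T\<in>{T. ?P T}. \<forall>S\<in>{T. ?P T}. T \<subseteq> S \<longrightarrow> T = S"
      by (rule finite_has_maximal)
    then obtain T where T: "?P T" and max: "\<And>S. ?P S \<Longrightarrow> T \<subseteq> S \<Longrightarrow> T = S"
      by auto
    have fin: "finite T" using T finite_subset by blast
    \<comment> \<open>Maximality of \<open>T\<close> yields a relation modulo \<open>Z\<close> on
      \<open>insert j T\<close>. Its coefficient at \<open>j\<close> is nonzero, for otherwise it
      would be a nontrivial relation on \<open>T\<close> alone.\<close>
    have "\<exists>c. (\<Sum>i<n. c i \<star> x i) \<in> Z \<and> c j \<noteq> 0 \<and> (\<forall>i. i \<notin> insert j T \<longrightarrow> c i = 0)"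
      if j: "j \<in> {..<n} - T" for j
    proof -
      have "\<not> indep_mod Z (insert j T) x"
        using max[of "insert j T"] T j by blast
      then obtain c where c: "(\<Sum>i\<in>insert j T. c i \<star> x i) \<in> Z" "\<exists>i\<in>insert j T. c i \<noteq> 0"
        unfolding indep_mod_def by blast
      have "c j \<noteq> 0"
      proof
        assume "c j = 0"
        then have "(\<Sum>i\<in>T. c i \<star> x i) \<in> Z" using c(1) j fin by simp
        then have "\<forall>i\<in>T. c i = 0" using T unfolding indep_mod_def by blast
        then show False using c(2) \<open>c j = 0\<close> by blast
      qed
      moreover have "(\<Sum>i<n. (if i \<in> insert j T then c i else 0) \<star> x i) = (\<Sum>i\<in>insert j T. c i \<star> x i)"
        using T j by (intro sum.mono_neutral_cong_right) auto
      ultimately show ?thesis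
        using c(1) by (intro exI[of _ "\<lambda>i. if i \<in> insert j T then c i else 0"]) simp
    qed
    then have "\<forall>j\<in>{..<n} - T. \<exists>c. (\<Sum>i<n. c i \<star> x i) \<in> Z \<and> c j \<noteq> 0 \<and> (\<forall>i. i \<notin> insert j T \<longrightarrow> c i = 0)"
      by (rule ballI)
    from bchoice[OF this] obtain c where c: "\<And>j. j \<in> {..<n} - T \<Longrightarrow> (\<Sum>i<n. c j i \<star> x i) \<in> Z"
      "\<And>j. j \<in> {..<n} - T \<Longrightarrow> c j j \<noteq> 0"
      "\<And>j i. j \<in> {..<n} - T \<Longrightarrow> i \<notin> insert j T \<Longrightarrow> c j i = 0"
      by auto
    have "indep_mod B ({..<n} - T) (\<lambda>j. \<Sum>i<n. c j i \<star> x i)"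
      unfolding indep_mod_def
    proof (intro allI impI ballI)
      fix a j
      assume a: "(\<Sum>j\<in>{..<n} - T. a j \<star> (\<Sum>i<n. c j i \<star> x i)) \<in> B" and j: "j \<in> {..<n} - T"
      have "(\<Sum>j\<in>{..<n} - T. a j \<star> (\<Sum>i<n. c j i \<star> x i))
          = (\<Sum>i<n. (\<Sum>j\<in>{..<n} - T. a j * c j i) \<star> x i)"
        by (simp add: scale_sum_right scale_sum_left sum.swap[of _ "{..<n}"])
      then have "(\<Sum>k\<in>{..<n} - T. a k * c k j) = 0"
        using indep a j unfolding indep_mod_def by auto
      \<comment> \<open>For \<open>j\<close> outside \<open>T\<close>, the vector \<open>x j\<close>
        has a nonzero coefficient only in the \<open>j\<close>-th combination. The domain property
        then allows cancelling \<open>c j j\<close>.\<close>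
      moreover have "(\<Sum>k\<in>{..<n} - T. a k * c k j) = a j * c j j"
        using j c(3) by (subst sum.remove[OF _ j]) (auto intro!: sum.neutral)
      ultimately show "a j = 0" using c(2)[OF j] by simp
    qed
    then have "enat (card ({..<n} - T)) \<le> rel_rank Z B"
      using c(1) by (intro card_le_rel_rank) auto
    moreover have "enat (card T) \<le> rel_rank Y Z"
      using T x fin card_le_rel_rank[of T x Y Z] by auto
    moreover have "n = card T + card ({..<n} - T)"
      using T fin card_mono[of "{..<n}" T] by (simp add: card_Diff_subset)
    ultimately show "enat n \<le> rel_rank Y Z + rel_rank Z B"
      unfolding enat_le_add_iff by blast
  next
    assume "enat n \<le> rel_rank Y Z + rel_rank Z B"
    then obtain p q y z where n: "n = p + q"
      and y: "\<And>i. i < p \<Longrightarrow> y i \<in> Y" "indep_mod Z {..<p} y"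
      and z: "\<And>i. i < q \<Longrightarrow> z i \<in> Z" "indep_mod B {..<q} z"
      unfolding enat_le_add_iff enat_le_rel_rank_iff by blast
    \<comment> \<open>Concatenation: a relation modulo \<open>B\<close> is first read modulo
      \<open>Z\<close>, which kills the coefficients of \<open>y\<close>, and then leaves a relation
      among the \<open>z\<close>.\<close>
    define x where "x i = (if i < p then y i else z (i - p))" for i
    have "x i \<in> Y" if "i < n" for i
      using that n y(1) z(1) assms(5) by (auto simp: x_def)
    moreover have "indep_mod B {..<n} x"
      unfolding indep_mod_def
    proof (intro allI impI)
      fix c assume c: "(\<Sum>i<n. c i \<star> x i) \<in> B"
      have split: "(\<Sum>i<n. c i \<star> x i) = (\<Sum>i<p. c i \<star> y i) + (\<Sum>i<q. c (p + i) \<star> z i)"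
        unfolding n by (induction q) (auto simp: x_def add.assoc)
      have zZ: "(\<Sum>i<q. c (p + i) \<star> z i) \<in> Z"
        using z(1) assms(2) by (auto intro!: subspace_sum subspace_scale)
      then have "(\<Sum>i<p. c i \<star> y i) \<in> Z"
        using subspace_diff[OF assms(2) _ zZ, of "\<Sum>i<n. c i \<star> x i"] c assms(4) split by auto
      then have c1: "\<forall>i<p. c i = 0" using y(2) unfolding indep_mod_def by auto
      then have "(\<Sum>i<q. c (p + i) \<star> z i) \<in> B" using c split by simp
      then have "\<forall>i<q. c (p + i) = 0"
        using z(2)[unfolded indep_mod_def, rule_format, of "\<lambda>i. c (p + i)"] by auto
      then show "\<forall>i\<in>{..<n}. c i = 0"
        using c1 n by (metis add_diff_inverse_nat lessThan_iff nat_add_left_cancel_less)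
    qed
    ultimately show "enat n \<le> rel_rank Y B" unfolding enat_le_rel_rank_iff by blast
  qed
qed

text \<open>Linearity is asked only on \<open>S\<close>, since homomorphisms of groups with carriers
  are controlled only on the carrier.\<close>

definition linear_on :: "'b set \<Rightarrow> ('b \<Rightarrow> 'b) \<Rightarrow> bool" where
  "linear_on S f \<longleftrightarrow> (\<forall>x\<in>S. \<forall>y\<in>S. f (x + y) = f x + f y) \<and> (\<forall>c. \<forall>x\<in>S. f (c \<star> x) = c \<star> f x)"

lemma linear_onI:
  assumes "\<And>x y. x \<in> S \<Longrightarrow> y \<in> S \<Longrightarrow> f (x + y) = f x + f y"
    and "\<And>c x. x \<in> S \<Longrightarrow> f (c \<star> x) = c \<star> f x"
  shows "linear_on S f"
  using assms by (simp add: linear_on_def)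

lemma linear_on_subset: "linear_on S f \<Longrightarrow> S' \<subseteq> S \<Longrightarrow> linear_on S' f"
  unfolding linear_on_def by blast

lemma linear_on_id: "linear_on S (\<lambda>x. x)"
  by (simp add: linear_on_def)

lemma linear_on_const_0: "linear_on S (\<lambda>x. 0)"
  by (simp add: linear_on_def)

lemma linear_on_comp:
  "linear_on S f \<Longrightarrow> f ` S \<subseteq> S' \<Longrightarrow> linear_on S' g \<Longrightarrow> linear_on S (\<lambda>x. g (f x))"
  unfolding linear_on_def by (auto simp: image_subset_iff)

lemma linear_on_plus:
  "linear_on S f \<Longrightarrow> linear_on S g \<Longrightarrow> linear_on S (\<lambda>x. f x + g x)"
  unfolding linear_on_def by (simp add: algebra_simps)

lemma linear_on_minus:
  "linear_on S f \<Longrightarrow> linear_on S (\<lambda>x. - f x)"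
  unfolding linear_on_def by simp

lemma linear_on_sum:
  "(\<And>i. i \<in> I \<Longrightarrow> linear_on S (f i)) \<Longrightarrow> linear_on S (\<lambda>x. \<Sum>i\<in>I. f i x)"
  by (induction I rule: infinite_finite_induct) (simp_all add: linear_on_const_0 linear_on_plus)

context
  fixes S f
  assumes lin: "linear_on S f" and sub: "subspace S"
begin

lemma linear_on_add: "x \<in> S \<Longrightarrow> y \<in> S \<Longrightarrow> f (x + y) = f x + f y"
  using lin by (simp add: linear_on_def)

lemma linear_on_scale: "x \<in> S \<Longrightarrow> f (c \<star> x) = c \<star> f x"
  using lin by (simp add: linear_on_def)

lemma linear_on_0: "f 0 = 0"
  using linear_on_scale[OF subspace_0[OF sub], of 0] by simp

lemma linear_on_neg: "x \<in> S \<Longrightarrow> f (- x) = - f x"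
  using linear_on_scale[of x "-1"] by simp

lemma linear_on_diff: "x \<in> S \<Longrightarrow> y \<in> S \<Longrightarrow> f (x - y) = f x - f y"
  using linear_on_add[of x "- y"] linear_on_neg[of y] subspace_neg[OF sub, of y] by simp

lemma linear_on_sum_apply: "(\<And>i. i \<in> I \<Longrightarrow> z i \<in> S) \<Longrightarrow> f (\<Sum>i\<in>I. z i) = (\<Sum>i\<in>I. f (z i))"
  by (induction I rule: infinite_finite_induct)
    (simp_all add: linear_on_0 linear_on_add subspace_sum[OF sub])

lemma subspace_linear_on_image: "subspace (f ` S)"
proof (rule subspaceI)
  show "0 \<in> f ` S" using linear_on_0 subspace_0[OF sub] by (metis imageI)
  show "x + y \<in> f ` S" if "x \<in> f ` S" "y \<in> f ` S" for x y
    using that by (auto simp: linear_on_add[symmetric] intro!: imageI subspace_add[OF sub])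
  show "c \<star> x \<in> f ` S" if "x \<in> f ` S" for c x
    using that by (auto simp: linear_on_scale[symmetric] intro!: imageI subspace_scale[OF sub])
qed

lemma subspace_linear_on_vimage:
  assumes "subspace A"
  shows "subspace {x \<in> S. f x \<in> A}"
  by (rule subspaceI)
    (auto simp: linear_on_0 linear_on_add linear_on_scale subspace_0 subspace_add subspace_scale sub assms)

end

text \<open>The hypotheses make \<open>f\<close> induce an isomorphism from Z/B to Z'/B': the
  membership equivalence gives injectivity, and surjectivity is asked only modulo \<open>B'\<close>.
  Independent families pass in both directions.\<close>

lemma rel_rank_iso:
  assumes "linear_on Z f" "subspace Z" "subspace B'"
    and mem: "\<And>z. z \<in> Z \<Longrightarrow> f z \<in> Z'" "\<And>z. z \<in> Z \<Longrightarrow> z \<in> B \<longleftrightarrow> f z \<in> B'"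
    and surj: "\<And>z'. z' \<in> Z' \<Longrightarrow> \<exists>z\<in>Z. z' - f z \<in> B'"
  shows "rel_rank Z B = rel_rank Z' B'"
proof (rule enat_eqI)
  fix n
  have comb: "(\<Sum>i<n. c i \<star> z i) \<in> B \<longleftrightarrow> (\<Sum>i<n. c i \<star> f (z i)) \<in> B'" if "\<And>i. i < n \<Longrightarrow> z i \<in> Z" for c and z :: "nat \<Rightarrow> 'b"
  proof -
    have "(\<Sum>i<n. c i \<star> z i) \<in> Z" using that by (auto intro!: subspace_sum subspace_scale assms(2))
    moreover have "f (\<Sum>i<n. c i \<star> z i) = (\<Sum>i<n. c i \<star> f (z i))"
      using that by (subst linear_on_sum_apply[OF assms(1,2)])
        (auto intro!: sum.cong subspace_scale assms(2) simp: linear_on_scale[OF assms(1,2)])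
    ultimately show ?thesis using mem(2)[of "\<Sum>i<n. c i \<star> z i"] by simp
  qed
  show "enat n \<le> rel_rank Z B \<longleftrightarrow> enat n \<le> rel_rank Z' B'"
    unfolding enat_le_rel_rank_iff
  proof
    assume "\<exists>z. (\<forall>i<n. z i \<in> Z) \<and> indep_mod B {..<n} z"
    then obtain z where z: "\<And>i. i < n \<Longrightarrow> z i \<in> Z" "indep_mod B {..<n} z" by blast
    then have "indep_mod B' {..<n} (\<lambda>i. f (z i))"
      unfolding indep_mod_def using comb[of z] by simp
    then show "\<exists>z'. (\<forall>i<n. z' i \<in> Z') \<and> indep_mod B' {..<n} z'"
      using z(1) mem(1) by (intro exI[of _ "\<lambda>i. f (z i)"]) auto
  next
    assume "\<exists>z'. (\<forall>i<n. z' i \<in> Z') \<and> indep_mod B' {..<n} z'"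
    then obtain z' where z': "\<And>i. i < n \<Longrightarrow> z' i \<in> Z'" "indep_mod B' {..<n} z'" by blast
    have "\<forall>i\<in>{..<n}. \<exists>x. x \<in> Z \<and> z' i - f x \<in> B'"
      using surj z'(1) by blast
    from bchoice[OF this] obtain z where
      z: "\<And>i. i < n \<Longrightarrow> z i \<in> Z" "\<And>i. i < n \<Longrightarrow> z' i - f (z i) \<in> B'"
      by auto
    have "indep_mod B {..<n} z"
      unfolding indep_mod_def
    proof (intro allI impI)
      fix c assume "(\<Sum>i<n. c i \<star> z i) \<in> B"
      then have "(\<Sum>i<n. c i \<star> f (z i)) \<in> B'" using comb[of z c] z(1) by simp
      \<comment> \<open>The lifts reproduce \<open>z'\<close> only up to elements of
        \<open>B'\<close>, an error that stays in \<open>B'\<close> under linear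
        combinations.\<close>
      moreover have "(\<Sum>i<n. c i \<star> (z' i - f (z i))) \<in> B'"
        using z(2) by (auto intro!: subspace_sum subspace_scale assms(3))
      ultimately have "(\<Sum>i<n. c i \<star> z' i) \<in> B'"
        using subspace_add[OF assms(3), of "\<Sum>i<n. c i \<star> f (z i)" "\<Sum>i<n. c i \<star> (z' i - f (z i))"]
        by (simp add: scale_right_diff_distrib sum_subtractf)
      then show "\<forall>i\<in>{..<n}. c i = 0" using z'(2) unfolding indep_mod_def by blast
    qed
    then show "\<exists>z. (\<forall>i<n. z i \<in> Z) \<and> indep_mod B {..<n} z" using z(1) by blast
  qed
qed

lemma rel_rank_second_iso:
  assumes "subspace W" "subspace B" "B \<subseteq> Y" "W \<subseteq> Y"
    and "\<And>y. y \<in> Y \<Longrightarrow> \<exists>x\<in>W. y - x \<in> B"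
  shows "rel_rank Y B = rel_rank W (W \<inter> B)"
  by (rule rel_rank_iso[symmetric, where f = "\<lambda>x. x"]) (use assms linear_on_id in auto)

end

section \<open>Rank relations of a filtered complex\<close>

text \<open>To be used with \<open>T\<close> the total complex, \<open>K\<close> its first two
  columns and \<open>L\<close> its first column. The assumption \<open>acyclic\<close> says that K/L
  has no homology; in degree 0 its premise on \<open>D n y\<close> is automatic, as
  \<open>D 0\<close> vanishes.\<close>

locale filtered_complex = domain_module scale
  for scale :: "'r::idom \<Rightarrow> 'b::ab_group_add \<Rightarrow> 'b" (infixr \<open>\<star>\<close> 75) +
  fixes T K L :: "nat \<Rightarrow> 'b set" and D :: "nat \<Rightarrow> 'b \<Rightarrow> 'b"
  assumes subspace_T: "subspace (T n)" and subspace_K: "subspace (K n)" and subspace_L: "subspace (L n)"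
    and L_K: "L n \<subseteq> K n" and K_T: "K n \<subseteq> T n"
    and D_linear: "linear_on (T n) (D n)"
    and D_0: "x \<in> T 0 \<Longrightarrow> D 0 x = 0"
    and D_T: "x \<in> T (Suc n) \<Longrightarrow> D (Suc n) x \<in> T n"
    and D_K: "x \<in> K (Suc n) \<Longrightarrow> D (Suc n) x \<in> K n"
    and D_L: "x \<in> L (Suc n) \<Longrightarrow> D (Suc n) x \<in> L n"
    and D_D: "x \<in> T (Suc n) \<Longrightarrow> D n (D (Suc n) x) = 0"
    and acyclic: "y \<in> K n \<Longrightarrow> D n y \<in> L (n - 1) \<Longrightarrow> \<exists>u\<in>K (Suc n). y + D (Suc n) u \<in> L n"
begin

definition "Z n = {x \<in> T n. D n x = 0}"
definition "B n = D (Suc n) ` T (Suc n)"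
definition "ZL n = {x \<in> L n. D n x = 0}"
definition "BL n = D (Suc n) ` L (Suc n)"

text \<open>Cycles and boundaries of the quotient complex \<open>T/K\<close>, as subspaces of \<open>T\<close>.\<close>

definition "ZQ n = {x \<in> T n. D n x \<in> K (n - 1)}"
definition "BQ n = {k + b | k b. k \<in> K n \<and> b \<in> B n}"

lemma L_T: "L n \<subseteq> T n"
  using L_K K_T by blast

lemmas D_add = linear_on_add[OF D_linear subspace_T]
lemmas D_diff = linear_on_diff[OF D_linear subspace_T]

lemma subspace_Z: "subspace (Z n)"
  using subspace_linear_on_vimage[OF D_linear subspace_T subspace_single_0] by (simp add: Z_def)

lemma subspace_B: "subspace (B n)"
  unfolding B_def by (rule subspace_linear_on_image[OF D_linear subspace_T])

lemma subspace_ZL: "subspace (ZL n)"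
  using subspace_linear_on_vimage[OF linear_on_subset[OF D_linear L_T] subspace_L subspace_single_0]
  by (simp add: ZL_def)

lemma subspace_BL: "subspace (BL n)"
  unfolding BL_def by (rule subspace_linear_on_image[OF linear_on_subset[OF D_linear L_T] subspace_L])

lemma subspace_ZQ: "subspace (ZQ n)"
  unfolding ZQ_def by (rule subspace_linear_on_vimage[OF D_linear subspace_T subspace_K])

lemma subspace_BQ: "subspace (BQ n)"
  unfolding BQ_def by (rule subspace_set_plus[OF subspace_K subspace_B])

lemma B_Z: "B n \<subseteq> Z n"
  using D_T D_D by (auto simp: B_def Z_def)

lemma ZL_Z: "ZL n \<subseteq> Z n"
  using L_T by (auto simp: ZL_def Z_def)

lemma BL_ZL: "BL n \<subseteq> ZL n"
  using D_L D_D L_T[THEN subsetD] by (auto simp: BL_def ZL_def)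

lemma BL_B: "BL n \<subseteq> B n"
  using L_T by (auto simp: BL_def B_def)

lemma B_BQ: "B n \<subseteq> BQ n"
  using subspace_0[OF subspace_K] by (force simp: BQ_def)

lemma K_BQ: "K n \<subseteq> BQ n"
  using subspace_0[OF subspace_B] by (force simp: BQ_def)

lemma D_K': "x \<in> K n \<Longrightarrow> D n x \<in> K (n - 1)"
  using D_K D_0 K_T[THEN subsetD] subspace_0[OF subspace_K] by (cases n) auto

lemma Z_ZQ: "Z n \<subseteq> ZQ n"
  using subspace_0[OF subspace_K] by (auto simp: Z_def ZQ_def)

lemma K_ZQ: "K n \<subseteq> ZQ n"
  using D_K'[of _ n] K_T[of n] by (auto simp: ZQ_def)

lemma BQ_ZQ: "BQ n \<subseteq> ZQ n"
proof
  fix x assume "x \<in> BQ n"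
  then obtain k b where "x = k + b" "k \<in> K n" "b \<in> B n" unfolding BQ_def by blast
  then show "x \<in> ZQ n"
    using K_ZQ Z_ZQ B_Z subspace_add[OF subspace_ZQ] by blast
qed

lemma B_self: "u \<in> T (Suc n) \<Longrightarrow> D (Suc n) u \<in> B n"
  unfolding B_def by blast

text \<open>The pieces of the long exact sequence: \<open>rank_a\<close> belongs to the image of
  H(L) in H(T), \<open>rank_b\<close> to the kernel of this map, and \<open>rank_i\<close> to the
  image of H(T) in H(T/K).\<close>

definition "rank_a n = rel_rank (ZL n) (ZL n \<inter> B n)"
definition "rank_b n = rel_rank (ZL n \<inter> B n) (BL n)"
definition "rank_i n = rel_rank (Z n) (Z n \<inter> BQ n)"

lemma rank_L: "rel_rank (ZL n) (BL n) = rank_a n + rank_b n"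
  unfolding rank_a_def rank_b_def
  by (rule rel_rank_chain) (use subspace_BL subspace_ZL subspace_B subspace_inter BL_ZL BL_B in auto)

text \<open>Exactness at H(T): what dies in H(T/K) comes from H(L). The \<open>K\<close>-part of
  such a cycle is itself a cycle, and acyclicity of K/L moves it into \<open>L\<close> by a
  boundary.\<close>

lemma Z_Int_BQ: "Z n \<inter> BQ n = {l + b | l b. l \<in> ZL n \<and> b \<in> B n}"
proof (intro equalityI subsetI)
  fix z assume "z \<in> Z n \<inter> BQ n"
  then obtain k b where z: "z = k + b" and k: "k \<in> K n" and b: "b \<in> B n" and "z \<in> Z n"
    unfolding BQ_def by blast
  then have kZ: "k \<in> Z n" using subspace_diff[OF subspace_Z, of z n b] B_Z by auto
  then have "D n k \<in> L (n - 1)" using subspace_0[OF subspace_L] by (auto simp: Z_def)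
  with acyclic[OF k] obtain u where u: "u \<in> K (Suc n)" and l: "k + D (Suc n) u \<in> L n" by blast
  have Du: "D (Suc n) u \<in> B n" using u K_T by (intro B_self) auto
  then have "k + D (Suc n) u \<in> Z n" using kZ B_Z subspace_add[OF subspace_Z] by blast
  then have "k + D (Suc n) u \<in> ZL n" using l by (simp add: ZL_def Z_def)
  moreover have "b - D (Suc n) u \<in> B n" using b Du subspace_diff[OF subspace_B] by blast
  moreover have "z = (k + D (Suc n) u) + (b - D (Suc n) u)" using z by simp
  ultimately show "z \<in> {l + b | l b. l \<in> ZL n \<and> b \<in> B n}" by blast
next
  fix z assume "z \<in> {l + b | l b. l \<in> ZL n \<and> b \<in> B n}"
  then obtain l b where z: "z = l + b" "l \<in> ZL n" "b \<in> B n" by blast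
  have "l \<in> K n" using z(2) L_K by (auto simp: ZL_def)
  then have "z \<in> BQ n" using z unfolding BQ_def by blast
  moreover have "z \<in> Z n" using z ZL_Z B_Z subspace_add[OF subspace_Z] by blast
  ultimately show "z \<in> Z n \<inter> BQ n" by blast
qed

lemma rank_T: "rel_rank (Z n) (B n) = rank_i n + rank_a n"
proof -
  have "rel_rank (Z n) (B n) = rel_rank (Z n) (Z n \<inter> BQ n) + rel_rank (Z n \<inter> BQ n) (B n)"
    using subspace_B subspace_Z subspace_BQ B_Z B_BQ by (intro rel_rank_chain subspace_inter) auto
  also have "rel_rank (Z n \<inter> BQ n) (B n) = rel_rank (ZL n) (ZL n \<inter> B n)"
  proof (rule rel_rank_second_iso[OF subspace_ZL subspace_B])
    show "B n \<subseteq> Z n \<inter> BQ n" using B_Z B_BQ by blast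
    show "ZL n \<subseteq> Z n \<inter> BQ n"
      unfolding Z_Int_BQ using subspace_0[OF subspace_B] by force
    show "\<exists>x\<in>ZL n. y - x \<in> B n" if "y \<in> Z n \<inter> BQ n" for y
    proof -
      from that obtain l b where "y = l + b" "l \<in> ZL n" "b \<in> B n" unfolding Z_Int_BQ by blast
      then show ?thesis by (intro bexI[of _ l]) simp_all
    qed
  qed
  finally show ?thesis by (simp add: rank_i_def rank_a_def)
qed

text \<open>The connecting homomorphism \<open>H(T/K) \<rightarrow> H(K) = H(L)\<close> is induced by \<open>D\<close> on the elements \<open>x\<close> of \<open>T\<close>
  with \<open>D x\<close> in \<open>L\<close>; they represent all of \<open>H(T/K)\<close> as \<open>K/L\<close> is acyclic.\<close>

lemma rank_Q: "rel_rank (ZQ (Suc n)) (BQ (Suc n)) = rank_b n + rank_i (Suc n)"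
proof -
  \<comment> \<open>\<open>M\<close> represents the image of H(T) in H(T/K), which is the kernel of
    the connecting homomorphism. So \<open>rank_i\<close> measures \<open>M\<close> modulo
    \<open>BQ\<close>, and \<open>rank_b\<close> what lies above \<open>M\<close>.\<close>
  define M where "M = {z + q | z q. z \<in> Z (Suc n) \<and> q \<in> BQ (Suc n)}"
  define W where "W = {x \<in> T (Suc n). D (Suc n) x \<in> L n}"
  have subM: "subspace M" unfolding M_def by (rule subspace_set_plus[OF subspace_Z subspace_BQ])
  have subW: "subspace W"
    unfolding W_def by (rule subspace_linear_on_vimage[OF D_linear subspace_T subspace_L])
  have BQ_M: "BQ (Suc n) \<subseteq> M" using subspace_0[OF subspace_Z] by (force simp: M_def)
  have Z_M: "Z (Suc n) \<subseteq> M" using subspace_0[OF subspace_BQ] by (force simp: M_def)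
  have M_ZQ: "M \<subseteq> ZQ (Suc n)"
  proof
    fix m assume "m \<in> M"
    then obtain z q where "m = z + q" "z \<in> Z (Suc n)" "q \<in> BQ (Suc n)" unfolding M_def by blast
    then show "m \<in> ZQ (Suc n)" using Z_ZQ BQ_ZQ subspace_add[OF subspace_ZQ] by blast
  qed
  have "rel_rank (ZQ (Suc n)) (BQ (Suc n)) = rel_rank (ZQ (Suc n)) M + rel_rank M (BQ (Suc n))"
    using subspace_BQ subM subspace_ZQ BQ_M M_ZQ by (intro rel_rank_chain)
  also have "rel_rank M (BQ (Suc n)) = rank_i (Suc n)"
    unfolding rank_i_def
  proof (rule rel_rank_second_iso[OF subspace_Z subspace_BQ BQ_M Z_M])
    show "\<exists>x\<in>Z (Suc n). y - x \<in> BQ (Suc n)" if "y \<in> M" for y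
    proof -
      from that obtain z q where "y = z + q" "z \<in> Z (Suc n)" "q \<in> BQ (Suc n)" unfolding M_def by blast
      then show ?thesis by (intro bexI[of _ z]) simp_all
    qed
  qed
  also have "rel_rank (ZQ (Suc n)) M = rel_rank W (W \<inter> M)"
  proof (rule rel_rank_second_iso[OF subW subM M_ZQ])
    show "W \<subseteq> ZQ (Suc n)" using L_K by (auto simp: W_def ZQ_def)
    show "\<exists>x\<in>W. y - x \<in> M" if "y \<in> ZQ (Suc n)" for y
    proof -
      from that have y: "y \<in> T (Suc n)" "D (Suc n) y \<in> K n" by (auto simp: ZQ_def)
      have "D n (D (Suc n) y) \<in> L (n - 1)" using D_D[OF y(1)] subspace_0[OF subspace_L] by simp
      with acyclic[OF y(2)] obtain u where u: "u \<in> K (Suc n)" "D (Suc n) y + D (Suc n) u \<in> L n" by blast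
      have uT: "u \<in> T (Suc n)" using u K_T by blast
      \<comment> \<open>Adding an element of \<open>K\<close> keeps the class of \<open>y\<close> in
        T/K and brings its differential into \<open>L\<close>.\<close>
      have "y + u \<in> W" using y u uT D_add subspace_add[OF subspace_T] by (simp add: W_def)
      moreover have "- u \<in> M" using subspace_neg[OF subspace_K u(1)] K_BQ BQ_M by blast
      ultimately show ?thesis by (intro bexI[of _ "y + u"]) simp_all
    qed
  qed
  also have "rel_rank W (W \<inter> M) = rank_b n"
    unfolding rank_b_def
  proof (rule rel_rank_iso[OF linear_on_subset[OF D_linear] subW subspace_BL])
    show "W \<subseteq> T (Suc n)" by (auto simp: W_def)
    show "D (Suc n) x \<in> ZL n \<inter> B n" if "x \<in> W" for x
      using that D_D B_self by (auto simp: W_def ZL_def)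
    show "x \<in> W \<inter> M \<longleftrightarrow> D (Suc n) x \<in> BL n" if x: "x \<in> W" for x
    proof
      assume "x \<in> W \<inter> M"
      then obtain z k b where xe: "x = z + (k + b)" and z: "z \<in> Z (Suc n)" and k: "k \<in> K (Suc n)"
        and b: "b \<in> B (Suc n)" unfolding M_def BQ_def by blast
      have kT: "k \<in> T (Suc n)" using k K_T by blast
      have zb: "z + b \<in> Z (Suc n)" using z b B_Z subspace_add[OF subspace_Z] by blast
      \<comment> \<open>Only \<open>k\<close> contributes to the differential of \<open>x\<close>.
        Acyclicity replaces \<open>k\<close> by an element of \<open>L\<close> with the same
        differential, so \<open>D x\<close> is a boundary in \<open>L\<close>.\<close>
      have "x = k + (z + b)" using xe by (simp add: algebra_simps)
      then have Dx: "D (Suc n) x = D (Suc n) k" using D_add[OF kT] zb by (auto simp: Z_def)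
      then have "D (Suc n) k \<in> L (Suc n - 1)" using x by (simp add: W_def)
      with acyclic[OF k] obtain u where u: "u \<in> K (Suc (Suc n))" and l: "k + D (Suc (Suc n)) u \<in> L (Suc n)"
        by blast
      have uT: "u \<in> T (Suc (Suc n))" using u K_T by blast
      have "D (Suc n) (k + D (Suc (Suc n)) u) = D (Suc n) k" using D_add[OF kT D_T[OF uT]] D_D[OF uT] by simp
      then show "D (Suc n) x \<in> BL n" unfolding BL_def using Dx l by (metis imageI)
    next
      assume "D (Suc n) x \<in> BL n"
      then obtain l where l: "l \<in> L (Suc n)" and eq: "D (Suc n) x = D (Suc n) l" unfolding BL_def by blast
      have "x - l \<in> Z (Suc n)"
        using x l L_T eq D_diff[of x "Suc n" l] subspace_diff[OF subspace_T, of x "Suc n" l]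
        by (auto simp: W_def Z_def)
      moreover have "l \<in> BQ (Suc n)" using l L_K K_BQ by blast
      moreover have "x = (x - l) + l" by simp
      ultimately show "x \<in> W \<inter> M" using x unfolding M_def by blast
    qed
    show "\<exists>x\<in>W. y - D (Suc n) x \<in> BL n" if "y \<in> ZL n \<inter> B n" for y
    proof -
      from that obtain x where "x \<in> T (Suc n)" "y = D (Suc n) x" "y \<in> L n" by (auto simp: B_def ZL_def)
      then show ?thesis using subspace_0[OF subspace_BL] by (intro bexI[of _ x]) (auto simp: W_def)
    qed
  qed
  finally show ?thesis .
qed

end

section \<open>Identities in the cyclic bicomplex\<close>

definition signed :: "nat \<Rightarrow> 'b::ab_group_add \<Rightarrow> 'b" where
  "signed i x = (if even i then x else - x)"

lemma signed_signed: "signed i (signed j x) = signed (i + j) x"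
  by (simp add: signed_def)

lemma signed_Suc: "signed (Suc i) x = - signed i x"
  by (simp add: signed_def)

text \<open>The cancellation behind both square-zero identities. The range, with \<open>j\<close>
  going one further than \<open>i\<close>, fits them both: \<open>M\<close> is n + 2 for
  \<open>bd\<close> and n + 1 for \<open>bd'\<close>.\<close>

lemma alternating_face_sum:
  fixes F :: "nat \<Rightarrow> nat \<Rightarrow> 'b::ab_group_add"
  assumes "\<And>i j. i < j \<Longrightarrow> j \<le> M \<Longrightarrow> F i j = F (j - 1) i"
  shows "(\<Sum>i<M. \<Sum>j\<le>M. signed (i + j) (F i j)) = 0"
proof -
  let ?f = "\<lambda>(i, j). signed (i + j) (F i j)"
  let ?A = "{(i, j). i < j \<and> j \<le> M}" and ?B = "{(i, j). j \<le> i \<and> i < M}"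
  have fin: "finite ?A" "finite ?B"
    by (rule finite_subset[of _ "{..M} \<times> {..M}"]; auto)+
  have "{..<M} \<times> {..M} = ?A \<union> ?B" by auto
  moreover have "?A \<inter> ?B = {}" by auto
  ultimately have "sum ?f ({..<M} \<times> {..M}) = sum ?f ?A + sum ?f ?B"
    using sum.union_disjoint[OF fin, of ?f] by simp
  moreover have "sum ?f ?A = (\<Sum>p\<in>?B. - ?f p)"
  \<comment> \<open>A pair with i < j is matched with (j - 1, i). The face identity equates the two
    terms, and the index sum drops by one, which flips the sign.\<close>
  proof (rule sum.reindex_bij_witness[where i = "\<lambda>(i, j). (j, Suc i)" and j = "\<lambda>(i, j). (j - 1, i)"])
    show "- ?f (case p of (i, j) \<Rightarrow> (j - 1, i)) = ?f p" if "p \<in> ?A" for p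
    proof -
      from that obtain i j where p: "p = (i, Suc j)" "i \<le> j" "Suc j \<le> M"
        by (cases p, cases "snd p") auto
      then show ?thesis using assms[of i "Suc j"] by (simp add: signed_Suc add.commute)
    qed
  qed auto
  ultimately show ?thesis by (simp add: sum.cartesian_product sum_negf)
qed

locale precyclic_module = domain_module scale
  for scale :: "'r::idom \<Rightarrow> 'b::ab_group_add \<Rightarrow> 'b" (infixr \<open>\<star>\<close> 75) +
  fixes C :: "nat \<Rightarrow> 'b set" and d :: "nat \<Rightarrow> nat \<Rightarrow> 'b \<Rightarrow> 'b"
    and T :: "nat \<Rightarrow> 'b \<Rightarrow> 'b" and s :: "nat \<Rightarrow> 'b \<Rightarrow> 'b"
  assumes subspace_C: "subspace (C n)"
    and d_closed: "x \<in> C (Suc n) \<Longrightarrow> i \<le> Suc n \<Longrightarrow> d (Suc n) i x \<in> C n"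
    and T_closed: "x \<in> C n \<Longrightarrow> T n x \<in> C n"
    and s_closed: "x \<in> C n \<Longrightarrow> s n x \<in> C (Suc n)"
    and d_linear: "i \<le> Suc n \<Longrightarrow> linear_on (C (Suc n)) (d (Suc n) i)"
    and T_linear: "linear_on (C n) (T n)"
    and s_linear: "linear_on (C n) (s n)"
    and d_d: "i < j \<Longrightarrow> j \<le> Suc (Suc n) \<Longrightarrow> x \<in> C (Suc (Suc n)) \<Longrightarrow>
               d (Suc n) i (d (Suc (Suc n)) j x) = d (Suc n) (j - 1) (d (Suc (Suc n)) i x)"
    and T_pow: "x \<in> C n \<Longrightarrow> (T n ^^ Suc n) x = x"
    and d_0_T: "x \<in> C (Suc n) \<Longrightarrow> d (Suc n) 0 (T (Suc n) x) = d (Suc n) (Suc n) x"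
    and d_T: "i \<le> n \<Longrightarrow> x \<in> C (Suc n) \<Longrightarrow> d (Suc n) (Suc i) (T (Suc n) x) = T n (d (Suc n) i x)"
    and d_s: "i \<le> n \<Longrightarrow> x \<in> C (Suc n) \<Longrightarrow> d (Suc (Suc n)) i (s (Suc n) x) = s n (d (Suc n) i x)"
    and d_n_s: "x \<in> C n \<Longrightarrow> d (Suc n) n (s n x) = x"
begin

text \<open>With the sign absorbed into each face, the cyclic relations for \<open>t\<close> become
  sign-free: face 0 after \<open>t\<close> is the last face, and face i + 1 after \<open>t\<close>
  is \<open>t\<close> after face i.\<close>

definition "e n i x = signed i (d n i x)"
definition "bd n x = (\<Sum>i\<le>n. e n i x)"
definition "bd' n x = (\<Sum>i<n. e n i x)"
definition "t n x = signed n (T n x)"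
definition "Nm n x = (\<Sum>k\<le>n. (t n ^^ k) x)"

lemma signed_closed: "x \<in> C n \<Longrightarrow> signed i x \<in> C n"
  using subspace_neg[OF subspace_C] by (simp add: signed_def)

lemma linear_on_signed: "linear_on S f \<Longrightarrow> linear_on S (\<lambda>x. signed i (f x))"
  using linear_on_minus by (cases "even i") (simp_all add: signed_def)

lemma e_closed: "x \<in> C (Suc n) \<Longrightarrow> i \<le> Suc n \<Longrightarrow> e (Suc n) i x \<in> C n"
  unfolding e_def by (intro signed_closed d_closed)

lemma e_linear: "i \<le> Suc n \<Longrightarrow> linear_on (C (Suc n)) (e (Suc n) i)"
  unfolding e_def by (intro linear_on_signed d_linear)

lemma bd_closed: "x \<in> C (Suc n) \<Longrightarrow> bd (Suc n) x \<in> C n"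
  unfolding bd_def by (rule subspace_sum[OF subspace_C]) (auto intro: e_closed)

lemma bd'_closed: "x \<in> C (Suc n) \<Longrightarrow> bd' (Suc n) x \<in> C n"
  unfolding bd'_def by (rule subspace_sum[OF subspace_C]) (auto intro: e_closed)

lemma bd_linear: "linear_on (C (Suc n)) (bd (Suc n))"
  unfolding bd_def by (rule linear_on_sum) (auto intro: e_linear)

lemma bd'_linear: "linear_on (C (Suc n)) (bd' (Suc n))"
  unfolding bd'_def by (rule linear_on_sum) (auto intro: e_linear)

lemma t_closed: "x \<in> C n \<Longrightarrow> t n x \<in> C n"
  unfolding t_def by (intro signed_closed T_closed)

lemma t_linear: "linear_on (C n) (t n)"
  unfolding t_def by (intro linear_on_signed T_linear)

lemma t_pow_closed: "x \<in> C n \<Longrightarrow> (t n ^^ k) x \<in> C n"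
  by (induction k) (simp_all add: t_closed)

lemma t_pow_linear: "linear_on (C n) (t n ^^ k)"
proof (induction k)
  case 0
  then show ?case using linear_on_id by (simp add: id_def)
next
  case (Suc k)
  have "linear_on (C n) (\<lambda>x. t n ((t n ^^ k) x))"
    by (rule linear_on_comp[OF Suc _ t_linear]) (use t_pow_closed in auto)
  then show ?case by (simp add: comp_def)
qed

lemma Nm_closed: "x \<in> C n \<Longrightarrow> Nm n x \<in> C n"
  unfolding Nm_def by (rule subspace_sum[OF subspace_C]) (rule t_pow_closed)

lemma Nm_linear: "linear_on (C n) (Nm n)"
  unfolding Nm_def by (rule linear_on_sum) (rule t_pow_linear)

lemma e_e: 
  assumes "x \<in> C (Suc (Suc n))" "i \<le> Suc n" "j \<le> Suc (Suc n)"
  shows "e (Suc n) i (e (Suc (Suc n)) j x) = signed (i + j) (d (Suc n) i (d (Suc (Suc n)) j x))"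
proof -
  have "d (Suc n) i (signed j (d (Suc (Suc n)) j x)) = signed j (d (Suc n) i (d (Suc (Suc n)) j x))"
    using linear_on_neg[OF d_linear subspace_C] assms d_closed by (simp add: signed_def)
  then show ?thesis by (simp add: e_def signed_signed)
qed

lemma bd_bd: 
  assumes x: "x \<in> C (Suc (Suc n))"
  shows "bd (Suc n) (bd (Suc (Suc n)) x) = 0"
proof -
  have "bd (Suc n) (bd (Suc (Suc n)) x)
      = (\<Sum>i<Suc (Suc n). \<Sum>j\<le>Suc (Suc n). e (Suc n) i (e (Suc (Suc n)) j x))"
    unfolding bd_def lessThan_Suc_atMost using x e_closed
    by (intro sum.cong refl linear_on_sum_apply[OF e_linear subspace_C]) auto
  also have "\<dots> = (\<Sum>i<Suc (Suc n). \<Sum>j\<le>Suc (Suc n).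
      signed (i + j) (d (Suc n) i (d (Suc (Suc n)) j x)))"
    using x by (intro sum.cong refl e_e) auto
  also have "\<dots> = 0" by (rule alternating_face_sum) (use d_d x in auto)
  finally show ?thesis .
qed

lemma bd'_bd': 
  assumes x: "x \<in> C (Suc (Suc n))"
  shows "bd' (Suc n) (bd' (Suc (Suc n)) x) = 0"
proof -
  have "bd' (Suc n) (bd' (Suc (Suc n)) x)
      = (\<Sum>i<Suc n. \<Sum>j\<le>Suc n. e (Suc n) i (e (Suc (Suc n)) j x))"
    unfolding bd'_def lessThan_Suc_atMost[of "Suc n"] using x e_closed
    by (intro sum.cong refl linear_on_sum_apply[OF e_linear subspace_C]) auto
  also have "\<dots> = (\<Sum>i<Suc n. \<Sum>j\<le>Suc n. signed (i + j) (d (Suc n) i (d (Suc (Suc n)) j x)))"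
    using x by (intro sum.cong refl e_e) auto
  also have "\<dots> = 0" by (rule alternating_face_sum) (use d_d x in auto)
  finally show ?thesis .
qed

section \<open>Faces against the signed cyclic operator and its norm\<close>

lemma e_0_t: "x \<in> C (Suc n) \<Longrightarrow> e (Suc n) 0 (t (Suc n) x) = e (Suc n) (Suc n) x"
  using d_0_T[of x n] linear_on_neg[OF d_linear subspace_C, of 0 n "T (Suc n) x"] T_closed[of x "Suc n"]
  by (simp add: e_def t_def signed_def)

lemma e_Suc_t:
  assumes "i \<le> n" "x \<in> C (Suc n)"
  shows "e (Suc n) (Suc i) (t (Suc n) x) = t n (e (Suc n) i x)"
  using d_T[OF assms] assms d_closed[of x n i] T_closed[of x "Suc n"]
    linear_on_neg[OF d_linear subspace_C, of "Suc i" n "T (Suc n) x"]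
    linear_on_neg[OF T_linear subspace_C, of "d (Suc n) i x" n]
  by (simp add: e_def t_def signed_def)

text \<open>By the cyclic relations the boundary of \<open>t x\<close> is the last signed face of
  \<open>x\<close> plus \<open>t\<close> applied to \<open>bd' x\<close>; that face cancels against
  the last term of \<open>bd x\<close>.\<close>

lemma bd_one_minus_t:
  assumes x: "x \<in> C (Suc n)"
  shows "bd (Suc n) (x - t (Suc n) x) = bd' (Suc n) x - t n (bd' (Suc n) x)"
proof -
  have "bd (Suc n) (t (Suc n) x) = e (Suc n) 0 (t (Suc n) x) + (\<Sum>i\<le>n. e (Suc n) (Suc i) (t (Suc n) x))"
    unfolding bd_def by (rule sum.atMost_Suc_shift)
  also have "(\<Sum>i\<le>n. e (Suc n) (Suc i) (t (Suc n) x)) = (\<Sum>i\<le>n. t n (e (Suc n) i x))"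
    using x by (intro sum.cong e_Suc_t) auto
  also have "\<dots> = t n (bd' (Suc n) x)"
    unfolding bd'_def lessThan_Suc_atMost using x e_closed
    by (intro linear_on_sum_apply[OF t_linear subspace_C, symmetric]) auto
  finally have "bd (Suc n) (t (Suc n) x) = e (Suc n) (Suc n) x + t n (bd' (Suc n) x)"
    using e_0_t[OF x] by simp
  moreover have "bd (Suc n) x = bd' (Suc n) x + e (Suc n) (Suc n) x"
    unfolding bd_def bd'_def by (simp add: lessThan_Suc_atMost)
  ultimately show ?thesis
    using linear_on_diff[OF bd_linear subspace_C x t_closed[OF x]] by simp
qed

lemma e_t_pow:
  assumes x: "x \<in> C (Suc n)"
  shows "j \<le> i \<Longrightarrow> i \<le> Suc n \<Longrightarrow> e (Suc n) i ((t (Suc n) ^^ j) x) = (t n ^^ j) (e (Suc n) (i - j) x)"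
proof (induction j arbitrary: i)
  case (Suc j)
  then obtain i' where i: "i = Suc i'" by (cases i) auto
  then show ?case
    using Suc e_Suc_t[of i' n "(t (Suc n) ^^ j) x"] t_pow_closed[OF x] by simp
qed simp

text \<open>After \<open>i\<close> steps the face index has come down to 0. The next step turns face
  0 into the last face and leaves no \<open>t\<close> outside, hence the exponent j - 1; the
  remaining steps go down from the last face.\<close>

lemma e_t_pow':
  assumes x: "x \<in> C (Suc n)" and "i < j" "j \<le> Suc n"
  shows "e (Suc n) i ((t (Suc n) ^^ j) x) = (t n ^^ (j - 1)) (e (Suc n) (Suc (Suc n) + i - j) x)"
proof -
  obtain k where j: "j = i + Suc k" using assms(2) less_natE by (metis add_Suc_right)
  have tk: "(t (Suc n) ^^ k) x \<in> C (Suc n)" by (rule t_pow_closed[OF x])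
  have "e (Suc n) i ((t (Suc n) ^^ j) x) = e (Suc n) i ((t (Suc n) ^^ i) (t (Suc n) ((t (Suc n) ^^ k) x)))"
    unfolding j by (simp only: funpow_add comp_apply funpow.simps)
  also have "\<dots> = (t n ^^ i) (e (Suc n) 0 (t (Suc n) ((t (Suc n) ^^ k) x)))"
    using e_t_pow[OF t_closed[OF tk], of i i] assms by simp
  also have "\<dots> = (t n ^^ i) ((t n ^^ k) (e (Suc n) (Suc n - k) x))"
    using e_t_pow[OF x, of k "Suc n"] e_0_t[OF tk] j assms by simp
  also have "\<dots> = (t n ^^ (j - 1)) (e (Suc n) (Suc (Suc n) + i - j) x)"
    by (simp add: j funpow_add)
  finally show ?thesis .
qed

lemma bd'_Nm:
  assumes x: "x \<in> C (Suc n)"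
  shows "bd' (Suc n) (Nm (Suc n) x) = Nm n (bd (Suc n) x)"
proof -
  have "bd' (Suc n) (Nm (Suc n) x) = (\<Sum>i\<le>n. \<Sum>j\<le>Suc n. e (Suc n) i ((t (Suc n) ^^ j) x))"
    unfolding bd'_def Nm_def lessThan_Suc_atMost using t_pow_closed[OF x]
    by (intro sum.cong refl linear_on_sum_apply[OF e_linear subspace_C]) auto
  also have "\<dots> = (\<Sum>(i, j)\<in>{..n} \<times> {..Suc n}. e (Suc n) i ((t (Suc n) ^^ j) x))"
    by (rule sum.cartesian_product)
  also have "\<dots> = (\<Sum>(l, k)\<in>{..n} \<times> {..Suc n}. (t n ^^ l) (e (Suc n) k x))"
  \<comment> \<open>The case distinction is whether the face index wraps around. Without wrapping l
    + k = i, at most n; with wrapping l + k = n + 1 + i. Hence l + k decides the case for the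
    inverse.\<close>
  proof (rule sum.reindex_bij_witness[where
        i = "\<lambda>(l, k). if l + k \<le> n then (l + k, l) else (l + k - Suc n, Suc l)" and
        j = "\<lambda>(i, j). if j \<le> i then (j, i - j) else (j - 1, Suc (Suc n) + i - j)"])
    show "(case (case p of (i, j) \<Rightarrow> if j \<le> i then (j, i - j) else (j - 1, Suc (Suc n) + i - j)) of
        (l, k) \<Rightarrow> (t n ^^ l) (e (Suc n) k x)) = (case p of (i, j) \<Rightarrow> e (Suc n) i ((t (Suc n) ^^ j) x))"
      if "p \<in> {..n} \<times> {..Suc n}" for p
    proof -
      from that obtain i j where p: "p = (i, j)" "i \<le> n" "j \<le> Suc n" by blast
      show ?thesis
        using e_t_pow[OF x, of j i] e_t_pow'[OF x, of i j] p by simp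
    qed
  qed (auto split: if_splits)
  also have "\<dots> = (\<Sum>l\<le>n. \<Sum>k\<le>Suc n. (t n ^^ l) (e (Suc n) k x))"
    by (rule sum.cartesian_product[symmetric])
  also have "\<dots> = Nm n (bd (Suc n) x)"
    unfolding Nm_def bd_def using x e_closed
    by (intro sum.cong refl linear_on_sum_apply[OF t_pow_linear subspace_C, symmetric]) auto
  finally show ?thesis .
qed

lemma t_pow_Suc:
  assumes x: "x \<in> C n"
  shows "(t n ^^ Suc n) x = x"
proof -
  have Tk: "(T n ^^ k) x \<in> C n" for k by (induction k) (simp_all add: x T_closed)
  \<comment> \<open>At k = n + 1 the sign exponent n(n + 1) is even, so no sign is left.\<close>
  have "(t n ^^ k) x = signed (n * k) ((T n ^^ k) x)" for k
  proof (induction k)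
    case (Suc k)
    have "T n (signed (n * k) ((T n ^^ k) x)) = signed (n * k) (T n ((T n ^^ k) x))"
      using linear_on_neg[OF T_linear subspace_C Tk] by (simp add: signed_def)
    then show ?case using Suc by (simp add: t_def signed_signed)
  qed (simp add: signed_def)
  from this[of "Suc n"] show ?thesis using T_pow[OF x] by (simp add: signed_def)
qed

text \<open>The sum over powers of \<open>t\<close> telescopes to the difference of \<open>x\<close>
  and its image under the power n + 1, which is \<open>x\<close> again.\<close>

lemma Nm_one_minus_t:
  assumes x: "x \<in> C n"
  shows "Nm n (x - t n x) = 0"
proof -
  have "(t n ^^ k) (x - t n x) = (t n ^^ k) x - (t n ^^ Suc k) x" for k
    using linear_on_diff[OF t_pow_linear subspace_C x t_closed[OF x]] by (simp add: funpow_swap1)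
  then have "Nm n (x - t n x) = (\<Sum>k<Suc n. (t n ^^ k) x - (t n ^^ Suc k) x)"
    by (simp only: Nm_def lessThan_Suc_atMost)
  also have "\<dots> = x - (t n ^^ Suc n) x"
    by (subst sum_lessThan_telescope') simp
  finally show ?thesis using t_pow_Suc[OF x] by simp
qed

lemma one_minus_t_Nm:
  assumes x: "x \<in> C n"
  shows "Nm n x - t n (Nm n x) = 0"
proof -
  have "t n (Nm n x) = (\<Sum>k\<le>n. t n ((t n ^^ k) x))"
    unfolding Nm_def by (rule linear_on_sum_apply[OF t_linear subspace_C]) (rule t_pow_closed[OF x])
  then have "Nm n x - t n (Nm n x) = (\<Sum>k<Suc n. (t n ^^ k) x - (t n ^^ Suc k) x)"
    by (simp add: Nm_def lessThan_Suc_atMost sum_subtractf)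
  also have "\<dots> = x - (t n ^^ Suc n) x"
    by (subst sum_lessThan_telescope') simp
  finally show ?thesis using t_pow_Suc[OF x] by simp
qed

text \<open>The last degeneracy contracts the odd columns: \<open>\<partial>' s - s \<partial>' = (-1)\<^sup>n\<close> on \<open>C n\<close>.\<close>

lemma bd'_exact:
  assumes y: "y \<in> C n" and cycle: "0 < n \<Longrightarrow> bd' n y = 0"
  shows "\<exists>v\<in>C (Suc n). bd' (Suc n) v = y"
proof -
  \<comment> \<open>Faces below \<open>n\<close> commute with \<open>s\<close> and add up to
    \<open>s\<close> of \<open>bd' n y\<close>, which is 0 for a cycle. Face \<open>n\<close> gives
    back \<open>y\<close> with its sign; in degree 0 it is the only face.\<close>
  have "bd' (Suc n) (s n y) = signed n y"
  proof (cases n)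
    case 0
    then show ?thesis using d_n_s[OF y] by (simp add: bd'_def e_def signed_def)
  next
    case (Suc m)
    have "(\<Sum>i<Suc m. e (Suc n) i (s n y)) = (\<Sum>i<Suc m. s m (e n i y))"
    proof (rule sum.cong)
      fix i assume i: "i \<in> {..<Suc m}"
      then show "e (Suc n) i (s n y) = s m (e n i y)"
        using d_s[of i m y] y d_closed[of y m i] Suc linear_on_neg[OF s_linear subspace_C]
        by (simp add: e_def signed_def)
    qed simp
    also have "\<dots> = s m (bd' n y)"
      unfolding bd'_def using y e_closed Suc
      by (subst linear_on_sum_apply[OF s_linear subspace_C]) auto
    also have "\<dots> = 0" using cycle Suc linear_on_0[OF s_linear subspace_C] by simp
    finally show ?thesis using d_n_s[OF y] Suc by (simp add: bd'_def e_def)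
  qed
  then have "bd' (Suc n) (signed n (s n y)) = y"
    using linear_on_neg[OF bd'_linear subspace_C s_closed[OF y]] by (auto simp: signed_def split: if_splits)
  then show ?thesis using signed_closed[OF s_closed[OF y]] by blast
qed

end

section \<open>The total complex\<close>

text \<open>Elements of the total complex are sequences of chains indexed by columns, so that all
  degrees lie in one module, as \<open>filtered_complex\<close> requires.\<close>

definition pointwise_scale :: "('r \<Rightarrow> 'b \<Rightarrow> 'b) \<Rightarrow> 'r \<Rightarrow> ('i \<Rightarrow> 'b) \<Rightarrow> 'i \<Rightarrow> 'b" where
  "pointwise_scale scl c f = (\<lambda>i. scl c (f i))"

context domain_module
begin

lemma domain_module_pointwise: "domain_module (pointwise_scale scale)"
  by unfold_locales (auto simp: pointwise_scale_def fun_eq_iff algebra_simps)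

end

context precyclic_module
begin

definition "vert (a::nat) m x = (if even a then bd m x else - bd' m x)"
definition "hor (a::nat) m x = (if odd a then x - t m x else Nm m x)"

text \<open>Entries beyond column \<open>n\<close> are 0, not \<open>undefined\<close> as for
  extensional functions; this makes each degree a subspace of the sequences.\<close>

definition "Tot n = {x. \<forall>a. if a \<le> n then x a \<in> C (n - a) else x a = 0}"

definition "Dt n x = (\<lambda>a. if a < n then vert a (n - a) (x a) + hor (Suc a) (n - 1 - a) (x (Suc a)) else 0)"

definition "cols01 n = {x \<in> Tot n. \<forall>a\<ge>2. x a = 0}"
definition "col0 n = {x \<in> Tot n. \<forall>a\<ge>1. x a = 0}"

lemma TotD: "x \<in> Tot n \<Longrightarrow> a \<le> n \<Longrightarrow> x a \<in> C (n - a)"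
  unfolding Tot_def by (metis (mono_tags, lifting) mem_Collect_eq)

lemma TotD_0: "x \<in> Tot n \<Longrightarrow> n < a \<Longrightarrow> x a = 0"
  unfolding Tot_def by (metis (mono_tags, lifting) leD mem_Collect_eq)

lemma TotI:
  "(\<And>a. a \<le> n \<Longrightarrow> x a \<in> C (n - a)) \<Longrightarrow> (\<And>a. n < a \<Longrightarrow> x a = 0) \<Longrightarrow> x \<in> Tot n"
  unfolding Tot_def by simp

lemma hor_closed: "x \<in> C m \<Longrightarrow> hor a m x \<in> C m"
  unfolding hor_def using Nm_closed t_closed subspace_diff[OF subspace_C] by simp

lemma hor_linear: "linear_on (C m) (hor a m)"
proof (cases "odd a")
  case True
  have "linear_on (C m) (\<lambda>x. x + - t m x)"
    by (intro linear_on_plus linear_on_minus linear_on_id t_linear)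
  then show ?thesis using True by (simp add: hor_def[abs_def])
qed (use Nm_linear in \<open>simp add: hor_def[abs_def]\<close>)

lemma vert_closed: "x \<in> C (Suc m) \<Longrightarrow> vert a (Suc m) x \<in> C m"
  unfolding vert_def using bd_closed bd'_closed subspace_neg[OF subspace_C] by simp

lemma vert_linear: "linear_on (C (Suc m)) (vert a (Suc m))"
  using bd_linear linear_on_minus[OF bd'_linear] by (cases "even a") (simp_all add: vert_def[abs_def])

lemma vert_vert: "x \<in> C (Suc (Suc m)) \<Longrightarrow> vert a (Suc m) (vert a (Suc (Suc m)) x) = 0"
  using bd_bd bd'_bd' linear_on_neg[OF bd'_linear subspace_C bd'_closed]
  by (simp add: vert_def)

lemma hor_hor: "x \<in> C m \<Longrightarrow> hor a m (hor (Suc a) m x) = 0"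
  using Nm_one_minus_t one_minus_t_Nm by (simp add: hor_def)

text \<open>The minus sign of \<open>vert\<close> on odd columns turns the commutation relations
  \<open>bd_one_minus_t\<close> and \<open>bd'_Nm\<close> into anticommutation.\<close>

lemma vert_hor:
  assumes x: "x \<in> C (Suc m)"
  shows "vert a (Suc m) (hor (Suc a) (Suc m) x) = - hor (Suc a) m (vert (Suc a) (Suc m) x)"
proof (cases "even a")
  case True
  then show ?thesis
    using bd_one_minus_t[OF x] linear_on_neg[OF t_linear subspace_C bd'_closed[OF x]]
    by (simp add: vert_def hor_def)
next
  case False
  then show ?thesis using bd'_Nm[OF x] by (simp add: vert_def hor_def)
qed

lemma hor_0: "hor a m 0 = 0"
  by (rule linear_on_0[OF hor_linear subspace_C])

lemma vert_0: "vert a (Suc m) 0 = 0"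
  by (rule linear_on_0[OF vert_linear subspace_C])

sublocale pw: domain_module "pointwise_scale scale"
  by (rule domain_module_pointwise)

lemma subspace_Tot: "pw.subspace (Tot n)"
  using subspace_C[THEN subspace_0] subspace_add[OF subspace_C] subspace_scale[OF subspace_C]
  by (intro pw.subspaceI) (auto simp: Tot_def pointwise_scale_def)

lemma Dt_closed: 
  assumes "x \<in> Tot (Suc n)"
  shows "Dt (Suc n) x \<in> Tot n"
proof (rule TotI)
  fix a assume a: "a \<le> n"
  have "x a \<in> C (Suc (n - a))" using TotD[OF assms, of a] a by (simp add: Suc_diff_le)
  moreover have "x (Suc a) \<in> C (n - a)" using TotD[OF assms, of "Suc a"] a by simp
  ultimately show "Dt (Suc n) x a \<in> C (n - a)"
    using a subspace_add[OF subspace_C vert_closed hor_closed] by (simp add: Dt_def Suc_diff_le)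
qed (simp add: Dt_def)

lemma Dt_linear: "pw.linear_on (Tot n) (Dt n)"
proof (cases n)
  case 0
  then show ?thesis by (intro pw.linear_onI) (auto simp: Dt_def pointwise_scale_def fun_eq_iff)
next
  case (Suc m)
  have mem: "x a \<in> C (Suc (m - a))" "x (Suc a) \<in> C (m - a)" if "x \<in> Tot (Suc m)" "a < Suc m" for x a
    using TotD[OF that(1), of a] TotD[OF that(1), of "Suc a"] that(2) by (simp_all add: Suc_diff_le)
  show ?thesis unfolding Suc
  proof (rule pw.linear_onI)
    fix x y assume xy: "x \<in> Tot (Suc m)" "y \<in> Tot (Suc m)"
    show "Dt (Suc m) (x + y) = Dt (Suc m) x + Dt (Suc m) y"
    proof
      fix a show "Dt (Suc m) (x + y) a = (Dt (Suc m) x + Dt (Suc m) y) a"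
        using linear_on_add[OF vert_linear subspace_C mem(1)[OF xy(1)] mem(1)[OF xy(2)], of a]
          linear_on_add[OF hor_linear subspace_C mem(2)[OF xy(1)] mem(2)[OF xy(2)], of a]
        by (auto simp: Dt_def Suc_diff_le less_Suc_eq_le ac_simps)
    qed
  next
    fix c x assume x: "x \<in> Tot (Suc m)"
    show "Dt (Suc m) (pointwise_scale scale c x) = pointwise_scale scale c (Dt (Suc m) x)"
    proof
      fix a show "Dt (Suc m) (pointwise_scale scale c x) a = pointwise_scale scale c (Dt (Suc m) x) a"
        using linear_on_scale[OF vert_linear subspace_C mem(1)[OF x], of a]
          linear_on_scale[OF hor_linear subspace_C mem(2)[OF x], of a]
        by (auto simp: Dt_def Suc_diff_le less_Suc_eq_le pointwise_scale_def scale_right_distrib)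
    qed
  qed
qed

lemma Dt_Dt:
  assumes x: "x \<in> Tot (Suc n)"
  shows "Dt n (Dt (Suc n) x) = 0"
proof
  fix a
  show "Dt n (Dt (Suc n) x) a = 0 a"
  proof (cases "a < n")
    case True
    \<comment> \<open>With this \<open>m\<close>, the columns a, a + 1, a + 2 of \<open>x\<close>
      lie in chain degrees m + 2, m + 1, m.\<close>
    then obtain m where n: "n = Suc (a + m)" using less_imp_Suc_add by blast
    have 0: "x a \<in> C (Suc (Suc m))" using TotD[OF x, of a] n by (simp add: Suc_diff_le)
    have 1: "x (Suc a) \<in> C (Suc m)" using TotD[OF x, of "Suc a"] n by simp
    have 2: "x (Suc (Suc a)) \<in> C m" using TotD[OF x, of "Suc (Suc a)"] n by simp
    have "Dt n (Dt (Suc n) x) a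
        = vert a (Suc m) (vert a (Suc (Suc m)) (x a) + hor (Suc a) (Suc m) (x (Suc a)))
        + hor (Suc a) m (vert (Suc a) (Suc m) (x (Suc a)) + hor (Suc (Suc a)) m (x (Suc (Suc a))))"
      using n by (simp add: Dt_def Suc_diff_le)
    also have "\<dots> = 0"
      by (simp add: linear_on_add[OF vert_linear subspace_C vert_closed[OF 0] hor_closed[OF 1]]
        linear_on_add[OF hor_linear subspace_C vert_closed[OF 1] hor_closed[OF 2]]
        vert_vert[OF 0] hor_hor[OF 2] vert_hor[OF 1])
    finally show ?thesis by simp
  qed (simp add: Dt_def)
qed

lemma Dt_cols01: "x \<in> cols01 (Suc n) \<Longrightarrow> Dt (Suc n) x \<in> cols01 n"
  using Dt_closed by (auto simp: cols01_def Dt_def hor_0 vert_0 Suc_diff_le less_Suc_eq_le)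

lemma Dt_col0: "x \<in> col0 (Suc n) \<Longrightarrow> Dt (Suc n) x \<in> col0 n"
  using Dt_closed by (auto simp: col0_def Dt_def hor_0 vert_0 Suc_diff_le less_Suc_eq_le)

text \<open>The first two columns modulo the first are column 1, whose differential is
  \<open>bd'\<close> up to sign and hence exact by \<open>bd'_exact\<close>.\<close>

lemma cols01_acyclic:
  assumes y: "y \<in> cols01 n" and Dy: "Dt n y \<in> col0 (n - 1)"
  shows "\<exists>u\<in>cols01 (Suc n). y + Dt (Suc n) u \<in> col0 n"
proof (cases n)
  case 0
  then have "y + Dt (Suc n) 0 \<in> col0 n"
    using y pw.linear_on_0[OF Dt_linear subspace_Tot] by (auto simp: cols01_def col0_def TotD_0)
  then show ?thesis
    using pw.subspace_0[OF subspace_Tot] by (intro bexI[of _ 0]) (auto simp: cols01_def)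
next
  case (Suc m)
  have yT: "y \<in> Tot (Suc m)" and y2: "\<And>a. 2 \<le> a \<Longrightarrow> y a = 0" using y Suc by (auto simp: cols01_def)
  have y1: "y 1 \<in> C m" using TotD[OF yT, of 1] by simp
  have "bd' m (y 1) = 0" if "0 < m"
  proof -
    have "Dt n y 1 = 0" using Dy by (simp add: col0_def)
    then show ?thesis using that Suc y2 by (simp add: Dt_def hor_0 vert_def)
  qed
  from bd'_exact[OF y1 this] obtain v where v: "v \<in> C (Suc m)" "bd' (Suc m) v = y 1" by blast
  \<comment> \<open>In column 1 the vertical differential is minus \<open>bd'\<close>, so the total
    differential of \<open>v\<close> placed there cancels \<open>y 1\<close>.\<close>
  define u where "u = (\<lambda>a::nat. if a = 1 then v else (0::'b))"
  have u: "u \<in> cols01 (Suc n)"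
    using v(1) subspace_0[OF subspace_C] by (auto simp: cols01_def u_def Suc intro!: TotI)
  then have "u \<in> Tot (Suc n)" by (simp add: cols01_def)
  then have "y + Dt (Suc n) u \<in> Tot n"
    using pw.subspace_add[OF subspace_Tot] yT Dt_closed Suc by blast
  moreover have "(y + Dt (Suc n) u) a = 0" if "1 \<le> a" for a
  proof (cases "a = 1")
    case True
    then show ?thesis using v(2) Suc by (simp add: Dt_def u_def hor_0 vert_def)
  next
    case False
    then have "2 \<le> a" using that by simp
    then show ?thesis using y2 by (simp add: Dt_def u_def hor_0 vert_0 Suc_diff_le less_Suc_eq_le)
  qed
  ultimately have "y + Dt (Suc n) u \<in> col0 n" by (simp add: col0_def)
  then show ?thesis using u by blast
qed

text \<open>From here on the homology of \<open>L\<close> stands for \<open>CH\<close> and that of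
  the whole complex for \<open>CHC\<close>.\<close>

sublocale cyc: filtered_complex "pointwise_scale scale" Tot cols01 col0 Dt
proof unfold_locales
  fix n
  show "pw.subspace (cols01 n)"
    using subspace_Tot[of n] by (auto simp: cols01_def pw.subspace_def pointwise_scale_def)
  show "pw.subspace (col0 n)"
    using subspace_Tot[of n] by (auto simp: col0_def pw.subspace_def pointwise_scale_def)
qed (use subspace_Tot Dt_linear Dt_closed Dt_Dt Dt_cols01 Dt_col0 cols01_acyclic
    in \<open>auto simp: cols01_def col0_def Dt_def fun_eq_iff\<close>)

text \<open>Periodicity: dropping the first two columns identifies the quotient of the total complex by
  them with the total complex, shifted by two degrees.\<close>

lemma rank_shift: "pw.rel_rank (cyc.ZQ (Suc (Suc n))) (cyc.BQ (Suc (Suc n))) = pw.rel_rank (cyc.Z n) (cyc.B n)"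
proof -
  \<comment> \<open>\<open>g\<close> forgets the first two columns, and its section \<open>f\<close>
    inserts two zero columns. As \<open>vert\<close> and \<open>hor\<close> depend only on the
    parity of the column, \<open>g\<close> commutes with the differential.\<close>
  define g :: "(nat \<Rightarrow> 'b) \<Rightarrow> nat \<Rightarrow> 'b" where "g y = (\<lambda>a. y (Suc (Suc a)))" for y
  define f :: "(nat \<Rightarrow> 'b) \<Rightarrow> nat \<Rightarrow> 'b" where "f x = (\<lambda>a. if a < 2 then 0 else x (a - 2))" for x
  have gf: "g (f x) = x" for x by (simp add: g_def f_def)
  have g_add: "g (x + y) = g x + g y" and g_diff: "g (x - y) = g x - g y" for x y
    by (auto simp: g_def)
  have gT: "g y \<in> Tot n" if "y \<in> Tot (Suc (Suc n))" for y n
    using TotD[OF that] TotD_0[OF that] by (intro TotI) (fastforce simp: g_def)+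
  have fT: "f x \<in> Tot (Suc (Suc n))" if "x \<in> Tot n" for x n
  proof (rule TotI)
    fix a assume "a \<le> Suc (Suc n)"
    then show "f x a \<in> C (Suc (Suc n) - a)"
      using TotD[OF that, of "a - 2"] subspace_0[OF subspace_C]
      by (auto simp: f_def numeral_2_eq_2 Suc_diff_le le_diff_conv not_less)
  next
    fix a assume "Suc (Suc n) < a"
    then show "f x a = 0" using TotD_0[OF that, of "a - 2"] by (simp add: f_def)
  qed
  have Dg: "Dt n (g y) = g (Dt (Suc (Suc n)) y)" for y n
    by (auto simp: Dt_def g_def vert_def hor_def fun_eq_iff)
  have cols: "y \<in> cols01 m \<longleftrightarrow> y \<in> Tot m \<and> g y = 0" for y m
  proof
    assume "y \<in> Tot m \<and> g y = 0"
    then have "y \<in> Tot m" and g0: "\<And>a. y (Suc (Suc a)) = 0" by (auto simp: g_def fun_eq_iff)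
    moreover have "y a = 0" if "2 \<le> a" for a using g0[of "a - 2"] that by (metis add_2_eq_Suc le_add_diff_inverse)
    ultimately show "y \<in> cols01 m" by (simp add: cols01_def)
  qed (auto simp: cols01_def g_def)
  have B_iff: "y \<in> cyc.BQ (Suc (Suc n)) \<longleftrightarrow> g y \<in> cyc.B n" if y: "y \<in> Tot (Suc (Suc n))" for y
  proof
    assume "y \<in> cyc.BQ (Suc (Suc n))"
    then obtain k w where k: "k \<in> cols01 (Suc (Suc n))" and w: "w \<in> Tot (Suc (Suc (Suc n)))"
      and "y = k + Dt (Suc (Suc (Suc n))) w" unfolding cyc.BQ_def cyc.B_def by blast
    then have "g y = Dt (Suc n) (g w)" using cols g_add Dg by simp
    then show "g y \<in> cyc.B n" unfolding cyc.B_def using gT[OF w] by blast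
  next
    assume "g y \<in> cyc.B n"
    then obtain w where w: "w \<in> Tot (Suc n)" "g y = Dt (Suc n) w" unfolding cyc.B_def by blast
    \<comment> \<open>\<open>f\<close> need not commute with the differential: the norm may produce
      an entry of \<open>b\<close> in column 1. It is absorbed by \<open>cols01\<close>.\<close>
    define b where "b = Dt (Suc (Suc (Suc n))) (f w)"
    have b: "b \<in> cyc.B (Suc (Suc n))" unfolding b_def cyc.B_def using fT[OF w(1)] by blast
    have bT: "b \<in> Tot (Suc (Suc n))" unfolding b_def by (rule Dt_closed[OF fT[OF w(1)]])
    have "g (y - b) = 0" using w(2) by (simp add: g_diff b_def Dg[symmetric] gf)
    then have "y - b \<in> cols01 (Suc (Suc n))" using cols pw.subspace_diff[OF subspace_Tot y bT] by blast
    moreover have "y = (y - b) + b" by simp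
    ultimately show "y \<in> cyc.BQ (Suc (Suc n))" unfolding cyc.BQ_def using b by blast
  qed
  have Z_iff: "y \<in> cyc.ZQ (Suc (Suc n)) \<longleftrightarrow> g y \<in> cyc.Z n" if y: "y \<in> Tot (Suc (Suc n))" for y
    using y gT[OF y] Dt_closed[OF y] cols Dg by (auto simp: cyc.ZQ_def cyc.Z_def)
  show ?thesis
  proof (rule pw.rel_rank_iso[OF _ cyc.subspace_ZQ cyc.subspace_B])
    show "pw.linear_on (cyc.ZQ (Suc (Suc n))) g"
      by (rule pw.linear_onI) (auto simp: g_def pointwise_scale_def)
    show "g z \<in> cyc.Z n" if "z \<in> cyc.ZQ (Suc (Suc n))" for z
      using that Z_iff[of z] by (auto simp: cyc.ZQ_def)
    show "z \<in> cyc.BQ (Suc (Suc n)) \<longleftrightarrow> g z \<in> cyc.B n" if "z \<in> cyc.ZQ (Suc (Suc n))" for z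
      using that B_iff[of z] by (auto simp: cyc.ZQ_def)
    show "\<exists>z\<in>cyc.ZQ (Suc (Suc n)). z' - g z \<in> cyc.B n" if z': "z' \<in> cyc.Z n" for z'
    proof (rule bexI[of _ "f z'"])
      have "z' \<in> Tot n" using z' by (simp add: cyc.Z_def)
      then show "f z' \<in> cyc.ZQ (Suc (Suc n))" using Z_iff[OF fT] z' gf by simp
      show "z' - g (f z') \<in> cyc.B n" using gf pw.subspace_0[OF cyc.subspace_B] by simp
    qed
  qed
qed

text \<open>In degrees 0 and 1 the first two columns are everything, so T/K vanishes there. This
  supplies the starting values of the telescoping sum.\<close>

lemma cols01_low: "n < 2 \<Longrightarrow> cols01 n = Tot n"
  by (auto simp: cols01_def TotD_0)

lemma rank_Q_1: "pw.rel_rank (cyc.ZQ 1) (cyc.BQ 1) = 0"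
  using cyc.K_BQ[of 1] by (intro pw.rel_rank_eq_0) (auto simp: cyc.ZQ_def cols01_low)

lemma rank_i_0: "cyc.rank_i 0 = 0"
  using cyc.K_BQ[of 0] unfolding cyc.rank_i_def
  by (intro pw.rel_rank_eq_0) (auto simp: cyc.Z_def cols01_low)

abbreviation "rank_CH n \<equiv> pw.rel_rank (cyc.ZL n) (cyc.BL n)"
abbreviation "rank_CHC n \<equiv> pw.rel_rank (cyc.Z n) (cyc.B n)"

section \<open>Telescoping of the ranks when \<open>CH\<close> has finite ranks\<close>

context
  assumes finite_CH: "\<And>n. rank_CH n \<noteq> \<infinity>"
begin

lemma finite_a: "cyc.rank_a n \<noteq> \<infinity>" and finite_b: "cyc.rank_b n \<noteq> \<infinity>"
  using finite_CH[of n] unfolding cyc.rank_L plus_eq_infty_iff_enat by auto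

lemma rank_i_1: "cyc.rank_i 1 = 0" and rank_b_0: "cyc.rank_b 0 = 0"
  using cyc.rank_Q[of 0] rank_Q_1 by simp_all

text \<open>By periodicity this is the rank of the homology of T/K in degree n + 2, shared out
  between the image of the connecting map in \<open>CH\<close> of degree n + 1 and the image of
  \<open>CHC\<close> of degree n + 2.\<close>

lemma rank_CHC_eq: "rank_CHC n = cyc.rank_b (Suc n) + cyc.rank_i (Suc (Suc n))"
  using cyc.rank_Q[of "Suc n"] rank_shift[of n] by simp

text \<open>Induction in steps of two: \<open>rank_i\<close> at k + 2 is a summand of the rank of
  \<open>CHC\<close> in degree k, which is the sum of \<open>rank_i k\<close> and
  \<open>rank_a k\<close>.\<close>

lemma finite_i: "cyc.rank_i n \<noteq> \<infinity>"
proof (induction n rule: less_induct)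
  case (less n)
  consider "n = 0" | "n = 1" | k where "n = Suc (Suc k)" by (metis One_nat_def not0_implies_Suc)
  then show ?case
  proof cases
    case 3
    then have "cyc.rank_i k \<noteq> \<infinity>" using less by simp
    then have "rank_CHC k \<noteq> \<infinity>"
      using finite_a[of k] unfolding cyc.rank_T plus_eq_infty_iff_enat by blast
    then show ?thesis unfolding 3 rank_CHC_eq plus_eq_infty_iff_enat by blast
  qed (use rank_i_0 rank_i_1 in auto)
qed

lemma alternating_sum_CH:
  "(\<Sum>n\<le>m. (-1) ^ n * real (the_enat (rank_CH n)))
     = (-1) ^ m * (real (the_enat (rank_CHC m)) - real (the_enat (cyc.rank_i (Suc m))))"
proof -
  define a where "a n = real (the_enat (cyc.rank_a n))" for n
  define b where "b n = real (the_enat (cyc.rank_b n))" for n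
  define i where "i n = real (the_enat (cyc.rank_i n))" for n
  have the_add: "real (the_enat (x + y)) = real (the_enat x) + real (the_enat y)"
    if "x \<noteq> \<infinity>" "y \<noteq> \<infinity>" for x y
    using that by (cases x; cases y) auto
  have CH: "real (the_enat (rank_CH n)) = a n + b n" for n
    by (simp add: cyc.rank_L the_add finite_a finite_b a_def b_def)
  have CHC: "real (the_enat (rank_CHC n)) = i n + a n" for n
    by (simp add: cyc.rank_T the_add finite_a finite_i a_def i_def)
  \<comment> \<open>Equates the two expressions for the rank of \<open>CHC\<close>, one from
    \<open>rank_T\<close> and one from periodicity; it carries the induction on \<open>m\<close>
    below.\<close>
  have step: "i n + a n = b (Suc n) + i (Suc (Suc n))" for n
    unfolding CHC[symmetric] rank_CHC_eq by (simp add: the_add finite_b finite_i b_def i_def)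
  have zero: "i 0 = 0" "i 1 = 0" "b 0 = 0"
    using rank_i_0 rank_i_1 rank_b_0 by (simp_all add: i_def b_def zero_enat_def)
  have "(\<Sum>n\<le>m. (-1) ^ n * (a n + b n)) = (-1) ^ m * (i m + a m - i (Suc m))"
  proof (induction m)
    case 0
    then show ?case using zero by simp
  next
    case (Suc m)
    show ?case unfolding sum.atMost_Suc Suc step[of m] by (simp add: algebra_simps)
  qed
  then show ?thesis by (simp add: CH CHC i_def)
qed

text \<open>Rank 0 of \<open>CH\<close> forces \<open>rank_a n\<close> to vanish, so no rank of
  \<open>CHC\<close> comes from \<open>CH\<close> in this degree.\<close>

lemma rank_CHC_eq_rank_i:
  assumes "rank_CH n = 0"
  shows "rank_CHC n = cyc.rank_i n"
  using assms cyc.rank_L[of n] by (simp add: cyc.rank_T)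

lemma alternating_sum_CH_eq_CHC:
  assumes "rank_CH (Suc m) = 0"
  shows "(\<Sum>n\<le>m. (-1) ^ n * real (the_enat (rank_CH n)))
     = (-1) ^ m * (real (the_enat (rank_CHC m)) - real (the_enat (rank_CHC (Suc m))))"
  using alternating_sum_CH[of m] rank_CHC_eq_rank_i[OF assms] by simp

end

end

section \<open>Ranks of subquotients of commutative groups\<close>

lemma hom_finprod:
  assumes "comm_group G" "comm_group H" "h \<in> hom G H" "f \<in> A \<rightarrow> carrier G"
  shows "h (finprod G f A) = finprod H (\<lambda>i. h (f i)) A"
proof -
  interpret G: comm_group G by fact
  interpret H: comm_group H by fact
  interpret group_hom G H h using assms by unfold_locales
  show ?thesis
    using assms(4)
    by (induction A rule: infinite_finite_induct) (auto simp: Pi_iff)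
qed

text \<open>Carries multiplicatively written groups into the additive modules above; subgroups are
  then compared through their images.\<close>

locale additive_embedding = domain_module scale + comm_group G
  for scale :: "int \<Rightarrow> 'b::ab_group_add \<Rightarrow> 'b" (infixr \<open>\<star>\<close> 75) and G :: "'g monoid" (structure) +
  fixes emb :: "'g \<Rightarrow> 'b"
  assumes emb_mult: "x \<in> carrier G \<Longrightarrow> y \<in> carrier G \<Longrightarrow> emb (x \<otimes> y) = emb x + emb y"
    and emb_inj: "inj_on emb (carrier G)"
begin

lemma emb_one: "emb \<one> = 0"
  using emb_mult[of \<one> \<one>] by simp

lemma emb_inv: "x \<in> carrier G \<Longrightarrow> emb (inv x) = - emb x"
  using emb_mult[of x "inv x"] by (simp add: emb_one eq_neg_iff_add_eq_0 add.commute)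

lemma emb_nat_pow: "x \<in> carrier G \<Longrightarrow> emb (x [^] (n::nat)) = int n \<star> emb x"
  by (induction n) (simp_all add: emb_one emb_mult algebra_simps)

lemma emb_int_pow: "x \<in> carrier G \<Longrightarrow> emb (x [^] (k::int)) = k \<star> emb x"
  by (cases k rule: int_cases2) (simp_all add: int_pow_int int_pow_neg emb_nat_pow emb_inv)

lemma emb_finprod: "f \<in> A \<rightarrow> carrier G \<Longrightarrow> emb (finprod G f A) = (\<Sum>i\<in>A. emb (f i))"
  by (induction A rule: infinite_finite_induct) (auto simp: emb_one emb_mult Pi_iff)

text \<open>\<open>group_rank\<close> counts independent sets of cosets, \<open>rel_rank\<close>
  independent families of representatives. Choosing representatives passes from one to the
  other.\<close>

lemma group_rank_Mod:
  assumes B: "subgroup B G"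
  shows "group_rank (G Mod B) = rel_rank (emb ` carrier G) (emb ` B)"
proof -
  let ?Q = "G Mod B" and ?\<pi> = "\<lambda>x. B #> x"
  interpret Q: comm_group ?Q by (rule abelian_FactGroup[OF B])
  have \<pi>: "?\<pi> \<in> hom G ?Q"
    by (rule normal.r_coset_hom_Mod) (rule subgroup_imp_normal[OF B])
  have \<pi>_iff: "?\<pi> x = B \<longleftrightarrow> emb x \<in> emb ` B" if "x \<in> carrier G" for x
  proof -
    have "?\<pi> x = B \<longleftrightarrow> x \<in> B" using coset_join1 coset_join2 B that by blast
    also have "\<dots> \<longleftrightarrow> emb x \<in> emb ` B"
      using that subgroup.subset[OF B] by (metis emb_inj inj_on_image_mem_iff)
    finally show ?thesis .
  qed
  \<comment> \<open>The dictionary between the two notions of independence: a relation among cosets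
    is a combination of representatives that falls into \<open>B\<close>.\<close>
  have prod: "finprod ?Q (\<lambda>i. ?\<pi> (x i) [^]\<^bsub>?Q\<^esub> c i) I = \<one>\<^bsub>?Q\<^esub> \<longleftrightarrow> (\<Sum>i\<in>I. c i \<star> emb (x i)) \<in> emb ` B"
    if x: "x \<in> I \<rightarrow> carrier G" for x and c :: "_ \<Rightarrow> int" and I :: "'i set"
  proof -
    have cl: "(\<lambda>i. x i [^] c i) \<in> I \<rightarrow> carrier G" using x by auto
    have "finprod ?Q (\<lambda>i. ?\<pi> (x i) [^]\<^bsub>?Q\<^esub> c i) I = finprod ?Q (\<lambda>i. ?\<pi> (x i [^] c i)) I"
    proof (rule Q.finprod_cong')
      show "(\<lambda>i. ?\<pi> (x i [^] c i)) \<in> I \<rightarrow> carrier ?Q" using cl \<pi> by (auto simp: hom_def)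
      show "?\<pi> (x i) [^]\<^bsub>?Q\<^esub> c i = ?\<pi> (x i [^] c i)" if "i \<in> I" for i
        using hom_int_pow[OF \<pi>, of "x i" "c i"] x that is_group Q.is_group by auto
    qed simp
    also have "\<dots> = ?\<pi> (finprod G (\<lambda>i. x i [^] c i) I)"
      using hom_finprod[OF comm_group_axioms Q.comm_group_axioms \<pi> cl] by simp
    finally have "finprod ?Q (\<lambda>i. ?\<pi> (x i) [^]\<^bsub>?Q\<^esub> c i) I = \<one>\<^bsub>?Q\<^esub>
        \<longleftrightarrow> emb (finprod G (\<lambda>i. x i [^] c i) I) \<in> emb ` B"
      using \<pi>_iff[OF finprod_closed[OF cl]] by simp
    also have "emb (finprod G (\<lambda>i. x i [^] c i) I) = (\<Sum>i\<in>I. c i \<star> emb (x i))"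
      unfolding emb_finprod[OF cl] using x by (intro sum.cong refl emb_int_pow) auto
    finally show ?thesis .
  qed
  show ?thesis
  proof (rule antisym)
    show "group_rank ?Q \<le> rel_rank (emb ` carrier G) (emb ` B)"
      unfolding group_rank_def
    proof (rule Sup_least, clarify)
      fix S assume S: "finite S" "S \<subseteq> carrier ?Q" "int_independent ?Q S"
      then have "\<forall>u\<in>S. \<exists>x. x \<in> carrier G \<and> u = ?\<pi> x" by (auto simp: carrier_FactGroup)
      from bchoice[OF this] obtain x where x: "\<forall>u\<in>S. x u \<in> carrier G \<and> u = ?\<pi> (x u)" by blast
      have "indep_mod (emb ` B) S (\<lambda>u. emb (x u))"
        unfolding indep_mod_def
      proof (intro allI impI)
        fix c assume "(\<Sum>u\<in>S. c u \<star> emb (x u)) \<in> emb ` B"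
        then have "finprod ?Q (\<lambda>u. ?\<pi> (x u) [^]\<^bsub>?Q\<^esub> c u) S = \<one>\<^bsub>?Q\<^esub>"
          using prod[of x S c] x by auto
        moreover have "finprod ?Q (\<lambda>u. ?\<pi> (x u) [^]\<^bsub>?Q\<^esub> c u) S = finprod ?Q (\<lambda>u. u [^]\<^bsub>?Q\<^esub> c u) S"
          using x S(2) by (intro Q.finprod_cong') auto
        ultimately show "\<forall>u\<in>S. c u = 0" using S(3) unfolding int_independent_def by metis
      qed
      then show "enat (card S) \<le> rel_rank (emb ` carrier G) (emb ` B)"
        using S(1) x by (intro card_le_rel_rank) auto
    qed
    have "enat n \<le> group_rank ?Q" if "enat n \<le> rel_rank (emb ` carrier G) (emb ` B)" for n
    proof -
      from that obtain z where z: "\<forall>i<n. z i \<in> emb ` carrier G" "indep_mod (emb ` B) {..<n} z"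
        unfolding enat_le_rel_rank_iff by blast
      then have "\<forall>i\<in>{..<n}. \<exists>x. x \<in> carrier G \<and> z i = emb x" by auto
      from bchoice[OF this] obtain x where x: "\<forall>i\<in>{..<n}. x i \<in> carrier G \<and> z i = emb (x i)" by blast
      have indep: "\<forall>i\<in>{..<n}. c i = 0"
        if "finprod ?Q (\<lambda>i. ?\<pi> (x i) [^]\<^bsub>?Q\<^esub> c i) {..<n} = \<one>\<^bsub>?Q\<^esub>" for c :: "nat \<Rightarrow> int"
      proof -
        have "(\<Sum>i<n. c i \<star> emb (x i)) \<in> emb ` B" using prod[of x "{..<n}" c] x that by auto
        then have "(\<Sum>i<n. c i \<star> z i) \<in> emb ` B" using x by simp
        then show ?thesis using z(2) unfolding indep_mod_def by blast
      qed
      \<comment> \<open>Since \<open>group_rank\<close> counts sets, the family must not repeat a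
        coset: equal cosets would satisfy a relation with coefficients 1 and -1.\<close>
      have inj: "inj_on (\<lambda>i. ?\<pi> (x i)) {..<n}"
      proof (rule inj_onI, rule ccontr)
        fix i j assume ij: "i \<in> {..<n}" "j \<in> {..<n}" "?\<pi> (x i) = ?\<pi> (x j)" "i \<noteq> j"
        let ?c = "\<lambda>k. if k = i then 1 else if k = j then - 1 else (0::int)"
        have cl: "(\<lambda>k. ?\<pi> (x k) [^]\<^bsub>?Q\<^esub> ?c k) \<in> A \<rightarrow> carrier ?Q" if "A \<subseteq> {..<n}" for A
          using x that \<pi> by (auto simp: hom_def )
        have \<pi>j: "?\<pi> (x j) \<in> carrier ?Q" using x ij(2) \<pi> by (auto simp: hom_def)
        have "finprod ?Q (\<lambda>k. ?\<pi> (x k) [^]\<^bsub>?Q\<^esub> ?c k) {..<n} = finprod ?Q (\<lambda>k. ?\<pi> (x k) [^]\<^bsub>?Q\<^esub> ?c k) {i, j}"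
        proof (rule Q.finprod_mono_neutral_cong_right)
          show "(\<lambda>k. ?\<pi> (x k) [^]\<^bsub>?Q\<^esub> ?c k) \<in> {..<n} \<rightarrow> carrier ?Q" by (rule cl) simp
        qed (use ij in simp_all)
        also have "\<dots> = \<one>\<^bsub>?Q\<^esub>" 
          using ij \<pi>j Q.r_inv[OF \<pi>j] Q.int_pow_neg[OF \<pi>j, of 1]
          by (simp del: mult_FactGroup one_FactGroup)
        finally have "\<forall>k\<in>{..<n}. ?c k = 0" by (rule indep)
        from bspec[OF this ij(1)] show False by simp
      qed
      let ?S = "(\<lambda>i. ?\<pi> (x i)) ` {..<n}"
      have S: "?S \<subseteq> carrier ?Q" using x by (auto simp: carrier_FactGroup)
      have "int_independent ?Q ?S"
        unfolding int_independent_def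
      proof (intro allI impI)
        fix c :: "'g set \<Rightarrow> int" assume c: "finprod ?Q (\<lambda>u. u [^]\<^bsub>?Q\<^esub> c u) ?S = \<one>\<^bsub>?Q\<^esub>"
        have "finprod ?Q (\<lambda>i. ?\<pi> (x i) [^]\<^bsub>?Q\<^esub> c (?\<pi> (x i))) {..<n} = \<one>\<^bsub>?Q\<^esub>"
          using Q.finprod_reindex[OF _ inj, of "\<lambda>u. u [^]\<^bsub>?Q\<^esub> c u"] c S by (auto simp: Pi_iff)
        from indep[OF this] show "\<forall>u\<in>?S. c u = 0" by simp
      qed
      moreover have "card ?S = n" using card_image[OF inj] by simp
      ultimately show ?thesis
        unfolding group_rank_def using S by (intro Sup_upper) (auto intro!: exI[of _ ?S])
    qed
    then show "rel_rank (emb ` carrier G) (emb ` B) \<le> group_rank ?Q"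
      by (rule enat_leI)
  qed
qed

lemma subgroup_if_subspace:
  assumes "H \<subseteq> carrier G" "subspace (emb ` H)"
  shows "subgroup H G"
proof (rule subgroupI)
  have mem: "x \<in> H" if "x \<in> carrier G" "emb x \<in> emb ` H" for x
    using that assms(1) emb_inj by (meson inj_on_image_mem_iff)
  show "H \<subseteq> carrier G" by fact
  show "H \<noteq> {}" using subspace_0[OF assms(2)] by auto
  show "inv x \<in> H" if "x \<in> H" for x
    using that assms(1) subspace_neg[OF assms(2)] by (intro mem) (auto simp: emb_inv)
  show "x \<otimes> y \<in> H" if "x \<in> H" "y \<in> H" for x y
    using that assms(1) subspace_add[OF assms(2)] by (intro mem) (auto simp: emb_mult subset_iff)
qed

lemma group_rank_subquotient:
  assumes "H \<subseteq> carrier G" "subspace (emb ` H)" "B \<subseteq> H" "subspace (emb ` B)"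
  shows "group_rank (subgroup_generated G H Mod B) = rel_rank (emb ` H) (emb ` B)"
proof -
  have H: "subgroup H G" and B: "subgroup B G"
    using assms subgroup_if_subspace by auto
  have car: "carrier (subgroup_generated G H) = H"
    using H by (rule subgroup.carrier_subgroup_generated_subgroup)
  interpret H: additive_embedding scale "subgroup_generated G H" emb
  proof (intro additive_embedding.intro additive_embedding_axioms.intro domain_module_axioms)
    show "comm_group (subgroup_generated G H)"
      by (rule abelian_subgroup_generated[OF comm_group_axioms])
      show "emb (x \<otimes>\<^bsub>subgroup_generated G H\<^esub> y) = emb x + emb y"
      if "x \<in> carrier (subgroup_generated G H)" "y \<in> carrier (subgroup_generated G H)" for x y
      using that assms(1) emb_mult car by (simp add: subset_iff)
  qed (use car assms(1) emb_inj inj_on_subset in auto)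
  have "subgroup B (subgroup_generated G H)"
    using B assms(3) car subgroup_subgroup_generated_iff by blast
  from H.group_rank_Mod[OF this] show ?thesis by (simp add: car)
qed

end

text \<open>The common bridge for \<open>CH\<close> and \<open>CHC\<close>: once \<open>emb\<close>
  identifies cycles and boundaries, the rank of homology is a relative rank.\<close>

lemma group_rank_homology:
  assumes emb: "additive_embedding scl (C n) emb"
    and Z: "emb ` (if n = 0 then carrier (C n) else kernel (C n) (C (n - 1)) (D n)) = Z"
    and B: "emb ` D (Suc n) ` carrier (C (Suc n)) = B" "D (Suc n) ` carrier (C (Suc n)) \<subseteq> carrier (C n)"
    and sub: "Modules.module.subspace scl Z" "Modules.module.subspace scl B" "B \<subseteq> Z"
  shows "group_rank (homology C D (int n)) = domain_module.rel_rank scl Z B"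
proof -
  interpret additive_embedding scl "C n" emb by fact
  let ?Z = "if n = 0 then carrier (C n) else kernel (C n) (C (n - 1)) (D n)"
  have Z_car: "?Z \<subseteq> carrier (C n)" by (auto simp: kernel_def)
  have "D (Suc n) ` carrier (C (Suc n)) \<subseteq> ?Z"
    using sub(3) emb_inj B Z Z_car by (metis inj_on_image_subset_iff)
  from group_rank_subquotient[OF Z_car _ this] show ?thesis
    using Z B sub by (simp add: homology_def)
qed

section \<open>Precyclic free abelian groups\<close>

text \<open>The group operation here is the addition of finitely supported functions, with 0 as
  neutral element.\<close>

lemma finprod_free_Abelian_group:
  assumes "\<And>i. i \<in> A \<Longrightarrow> Poly_Mapping.keys (f i) \<subseteq> S"
  shows "finprod (free_Abelian_group S) f A = sum f A"
proof -
  interpret comm_group "free_Abelian_group S" by (rule abelian_free_Abelian_group)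
  show ?thesis
    using assms by (induction A rule: infinite_finite_induct) (auto simp: Pi_iff)
qed

lemma domain_module_frag_cmul: "domain_module frag_cmul"
  by unfold_locales (simp_all add: frag_cmul_distrib frag_cmul_distrib2)

lemma frag_cmul_signed: "frag_cmul ((- 1) ^ n) x = signed n x"
  by (cases "even n") (simp_all add: signed_def)

locale free_precyclic = precyclic_last_degeneracy "\<lambda>n. free_Abelian_group (S n)" d T s
  for S :: "nat \<Rightarrow> 'x set" and d T s
begin

abbreviation "C n \<equiv> free_Abelian_group (S n)"
definition "chain_set n = {c. Poly_Mapping.keys c \<subseteq> S n}"

lemma carrier_C: "carrier (C n) = chain_set n"
  by (auto simp: chain_set_def)

lemma keys_iff: "Poly_Mapping.keys c \<subseteq> S n \<longleftrightarrow> c \<in> chain_set n"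
  by (simp add: chain_set_def)

interpretation fr: domain_module frag_cmul
  by (rule domain_module_frag_cmul)

lemma linear_on_hom:
  assumes "h \<in> hom (C m) (C n)"
  shows "fr.linear_on (chain_set m) h"
proof (rule fr.linear_onI)
  show "h (x + y) = h x + h y" if "x \<in> chain_set m" "y \<in> chain_set m" for x y
    using hom_mult[OF assms, of x y] that by (simp add: chain_set_def)
  show "h (frag_cmul k x) = frag_cmul k (h x)" if "x \<in> chain_set m" for k x
    using hom_int_pow[OF assms, of x k] that hom_in_carrier[OF assms, of x]
    by (simp add: chain_set_def)
qed

sublocale pm: precyclic_module frag_cmul chain_set d T s
proof (intro precyclic_module.intro precyclic_module_axioms.intro domain_module_frag_cmul)
  fix n i j x
  show "fr.subspace (chain_set n)"
    by (rule fr.subspaceI) (auto simp: chain_set_def dest: keys_add[THEN subsetD] keys_cmul[THEN subsetD])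
  have d: "d (Suc n) i \<in> hom (C (Suc n)) (C n)" if "i \<le> Suc n" for i n
    using d_hom[of "Suc n" i] that by simp
  show "d (Suc n) i x \<in> chain_set n" if "x \<in> chain_set (Suc n)" "i \<le> Suc n"
    using hom_in_carrier[OF d] that by (simp add: carrier_C del: carrier_free_Abelian_group_iff)
  show "T n x \<in> chain_set n" if "x \<in> chain_set n"
    using hom_in_carrier[OF T_hom] that by (simp add: carrier_C del: carrier_free_Abelian_group_iff)
  show "s n x \<in> chain_set (Suc n)" if "x \<in> chain_set n"
    using hom_in_carrier[OF s_hom] that by (simp add: carrier_C del: carrier_free_Abelian_group_iff)
  show "fr.linear_on (chain_set (Suc n)) (d (Suc n) i)" if "i \<le> Suc n"
    using linear_on_hom[OF d[OF that]] .
  show "fr.linear_on (chain_set n) (T n)" by (rule linear_on_hom[OF T_hom])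
  show "fr.linear_on (chain_set n) (s n)" by (rule linear_on_hom[OF s_hom])
  show "d (Suc n) i (d (Suc (Suc n)) j x) = d (Suc n) (j - 1) (d (Suc (Suc n)) i x)"
    if "i < j" "j \<le> Suc (Suc n)" "x \<in> chain_set (Suc (Suc n))"
    using d_d[of "Suc (Suc n)" i j x] that by (simp add: keys_iff)
  show "(T n ^^ Suc n) x = x" if "x \<in> chain_set n"
    using T_pow[of x n] that by (simp add: keys_iff)
  show "d (Suc n) 0 (T (Suc n) x) = d (Suc n) (Suc n) x" if "x \<in> chain_set (Suc n)"
    using d_0_T[of "Suc n" x] that by (simp add: keys_iff)
  show "d (Suc n) (Suc i) (T (Suc n) x) = T n (d (Suc n) i x)" if "i \<le> n" "x \<in> chain_set (Suc n)"
    using d_T[of "Suc i" "Suc n" x] that by (simp add: keys_iff)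
  show "d (Suc (Suc n)) i (s (Suc n) x) = s n (d (Suc n) i x)" if "i \<le> n" "x \<in> chain_set (Suc n)"
    using d_s[of "Suc n" i x] that by (simp add: keys_iff)
  show "d (Suc n) n (s n x) = x" if "x \<in> chain_set n"
    using d_n_s[of x n] that by (simp add: keys_iff)
qed

lemma bdry_eq:
  assumes "x \<in> chain_set (Suc n)"
  shows "bdry C d (Suc n) x = pm.bd (Suc n) x"
proof -
  have "d (Suc n) i x [^]\<^bsub>C n\<^esub> ((- 1) ^ i :: int) = pm.e (Suc n) i x" if "i \<le> Suc n" for i
    using pm.d_closed[OF assms that] by (simp add: pm.e_def keys_iff frag_cmul_signed)
  then have "bdry C d (Suc n) x = finprod (C n) (\<lambda>i. pm.e (Suc n) i x) {..Suc n}"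
    unfolding bdry_def diff_Suc_1 using pm.e_closed[OF assms]
    by (intro comm_monoid.finprod_cong')
      (auto intro: comm_group.axioms(1)[OF abelian_free_Abelian_group] simp: keys_iff)
  also have "\<dots> = pm.bd (Suc n) x"
    unfolding pm.bd_def using pm.e_closed[OF assms]
    by (intro finprod_free_Abelian_group) (auto simp: keys_iff)
  finally show ?thesis .
qed

lemma bdry'_eq:
  assumes "x \<in> chain_set (Suc n)"
  shows "bdry' C d (Suc n) x = pm.bd' (Suc n) x"
proof -
  have "d (Suc n) i x [^]\<^bsub>C n\<^esub> ((- 1) ^ i :: int) = pm.e (Suc n) i x" if "i < Suc n" for i
    using pm.d_closed[OF assms, of i] that by (simp add: pm.e_def keys_iff frag_cmul_signed)
  then have "bdry' C d (Suc n) x = finprod (C n) (\<lambda>i. pm.e (Suc n) i x) {..<Suc n}"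
    unfolding bdry'_def diff_Suc_1 using pm.e_closed[OF assms]
    by (intro comm_monoid.finprod_cong')
      (auto intro: comm_group.axioms(1)[OF abelian_free_Abelian_group] simp: keys_iff)
  also have "\<dots> = pm.bd' (Suc n) x"
    unfolding pm.bd'_def using pm.e_closed[OF assms]
    by (intro finprod_free_Abelian_group) (auto simp: keys_iff)
  finally show ?thesis .
qed

lemma signed_cyclic_eq: "x \<in> chain_set n \<Longrightarrow> signed_cyclic C T n x = pm.t n x"
  using pm.T_closed[of x n] by (simp add: signed_cyclic_def pm.t_def keys_iff frag_cmul_signed)

lemma cyclic_norm_eq:
  assumes "x \<in> chain_set n"
  shows "cyclic_norm C T n x = pm.Nm n x"
proof -
  have "(signed_cyclic C T n ^^ k) x = (pm.t n ^^ k) x" for k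
    by (induction k) (simp_all add: signed_cyclic_eq pm.t_pow_closed assms)
  then show ?thesis
    unfolding cyclic_norm_def pm.Nm_def using pm.t_pow_closed[OF assms]
    by (simp add: finprod_free_Abelian_group keys_iff)
qed

lemma cc_vertical_eq:
  assumes "x \<in> chain_set (Suc m)"
  shows "cc_vertical C d a (Suc m) x = pm.vert a (Suc m) x"
  using bdry_eq[OF assms] bdry'_eq[OF assms] pm.bd'_closed[OF assms]
  by (simp add: cc_vertical_def pm.vert_def keys_iff)

lemma cc_horizontal_eq:
  assumes "x \<in> chain_set m"
  shows "cc_horizontal C T a m x = pm.hor a m x"
  using pm.t_closed[OF assms]
  by (simp add: cc_horizontal_def pm.hor_def signed_cyclic_eq cyclic_norm_eq assms keys_iff)

text \<open>\<open>emb_col0\<close> serves \<open>CH\<close> and \<open>emb_total\<close> serves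
  \<open>CHC\<close>; both land in the same module of sequences. The latter replaces the
  \<open>undefined\<close> entries of the product group by 0.\<close>

definition "emb_col0 c = (\<lambda>a::nat. if a = 0 then c else 0)"
definition "emb_total n x = (\<lambda>a::nat. if a \<le> n then x a else 0)"

lemma additive_embedding_col0: "additive_embedding (pointwise_scale frag_cmul) (C n) emb_col0"
proof (intro additive_embedding.intro additive_embedding_axioms.intro abelian_free_Abelian_group
    pm.pw.domain_module_axioms)
qed (auto simp: emb_col0_def fun_eq_iff inj_on_def)

lemma carrier_cc_total: "carrier (cc_total C n) = (\<Pi>\<^sub>E a\<in>{..n}. chain_set (n - a))"
  by (simp add: cc_total_def carrier_C)

lemma additive_embedding_total: "additive_embedding (pointwise_scale frag_cmul) (cc_total C n) (emb_total n)"
proof (intro additive_embedding.intro additive_embedding_axioms.intro pm.pw.domain_module_axioms)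
  show "comm_group (cc_total C n)"
  proof (rule group.group_comm_groupI)
    show "group (cc_total C n)" unfolding cc_total_def by (rule product_group) simp
  qed (auto simp: cc_total_def add.commute intro!: restrict_ext)
  show "inj_on (emb_total n) (carrier (cc_total C n))"
  proof (rule inj_onI)
    fix x y assume xy: "x \<in> carrier (cc_total C n)" "y \<in> carrier (cc_total C n)" "emb_total n x = emb_total n y"
    have "x a = y a" if "a \<le> n" for a
      using fun_cong[OF xy(3), of a] that by (simp add: emb_total_def)
    then show "x = y" using xy(1,2) unfolding carrier_cc_total by (intro PiE_ext) auto
  qed
qed (auto simp: emb_total_def cc_total_def fun_eq_iff)

lemma emb_total_carrier: "emb_total n ` carrier (cc_total C n) = pm.Tot n"
proof (intro equalityI subsetI)
  fix y assume y: "y \<in> pm.Tot n"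
  have "restrict y {..n} \<in> carrier (cc_total C n)"
    using pm.TotD[OF y] unfolding carrier_cc_total by auto
  moreover have "emb_total n (restrict y {..n}) = y"
    using pm.TotD_0[OF y] by (auto simp: emb_total_def fun_eq_iff)
  ultimately show "y \<in> emb_total n ` carrier (cc_total C n)" by (metis imageI)
qed (auto simp: carrier_cc_total emb_total_def intro!: pm.TotI)

lemma emb_total_differential:
  assumes x: "x \<in> carrier (cc_total C (Suc n))"
  shows "emb_total n (cc_differential C d T (Suc n) x) = pm.Dt (Suc n) (emb_total (Suc n) x)"
proof
  fix a
  show "emb_total n (cc_differential C d T (Suc n) x) a = pm.Dt (Suc n) (emb_total (Suc n) x) a"
  proof (cases "a \<le> n")
    case True
    have "x a \<in> chain_set (Suc (n - a))" "x (Suc a) \<in> chain_set (n - a)"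
      using x True unfolding carrier_cc_total
      by (auto simp: PiE_iff Suc_diff_le dest: bspec[of _ _ a] bspec[of _ _ "Suc a"])
    then show ?thesis
      using True by (simp add: emb_total_def cc_differential_def pm.Dt_def Suc_diff_le
          cc_vertical_eq cc_horizontal_eq)
  qed (simp add: emb_total_def pm.Dt_def)
qed

lemma differential_closed:
  assumes x: "x \<in> carrier (cc_total C (Suc n))"
  shows "cc_differential C d T (Suc n) x \<in> carrier (cc_total C n)"
proof -
  have "emb_total (Suc n) x \<in> pm.Tot (Suc n)" using x emb_total_carrier by blast
  from pm.Dt_closed[OF this] have "emb_total n (cc_differential C d T (Suc n) x) \<in> pm.Tot n"
    unfolding emb_total_differential[OF x] .
  from pm.TotD[OF this] show ?thesis
    unfolding carrier_cc_total by (auto simp: emb_total_def cc_differential_def PiE_iff)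
qed

lemma group_rank_cc_total:
  "group_rank (homology (cc_total C) (cc_differential C d T) (int n)) = pm.rank_CHC n"
proof (rule group_rank_homology[OF additive_embedding_total])
  show "emb_total n ` (if n = 0 then carrier (cc_total C n)
      else kernel (cc_total C n) (cc_total C (n - 1)) (cc_differential C d T n)) = pm.cyc.Z n"
  proof (cases n)
    case 0
    then show ?thesis using emb_total_carrier[of 0] pm.cyc.D_0 by (auto simp: pm.cyc.Z_def)
  next
    case (Suc m)
    interpret m: additive_embedding "pointwise_scale frag_cmul" "cc_total C m" "emb_total m"
      by (rule additive_embedding_total)
    have "cc_differential C d T n x = \<one>\<^bsub>cc_total C m\<^esub> \<longleftrightarrow> pm.Dt n (emb_total n x) = 0"
      if x: "x \<in> carrier (cc_total C n)" for x
    proof -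
      \<comment> \<open>As the embedding is injective and sends the neutral element to 0, cycles can
        be recognized after embedding.\<close>
      have "cc_differential C d T n x = \<one>\<^bsub>cc_total C m\<^esub>
          \<longleftrightarrow> emb_total m (cc_differential C d T n x) = emb_total m \<one>\<^bsub>cc_total C m\<^esub>"
        using inj_on_eq_iff[OF m.emb_inj] differential_closed[of x m] x Suc m.one_closed by blast
      then show ?thesis using emb_total_differential[of x m] x Suc m.emb_one by simp
    qed
    then have "kernel (cc_total C n) (cc_total C (n - 1)) (cc_differential C d T n)
        = {x \<in> carrier (cc_total C n). pm.Dt n (emb_total n x) = 0}"
      using Suc by (auto simp: kernel_def)
    then show ?thesis
      unfolding pm.cyc.Z_def emb_total_carrier[symmetric] using Suc by auto
  qed
  show "emb_total n ` cc_differential C d T (Suc n) ` carrier (cc_total C (Suc n)) = pm.cyc.B n"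
    unfolding pm.cyc.B_def emb_total_carrier[symmetric] image_image
    by (rule image_cong[OF refl]) (rule emb_total_differential)
  show "cc_differential C d T (Suc n) ` carrier (cc_total C (Suc n)) \<subseteq> carrier (cc_total C n)"
    using differential_closed by blast
qed (rule pm.cyc.subspace_Z pm.cyc.subspace_B pm.cyc.B_Z)+

lemma emb_col0_carrier: "emb_col0 ` chain_set n = pm.col0 n"
proof (intro equalityI subsetI)
  fix y assume y: "y \<in> pm.col0 n"
  then have "emb_col0 (y 0) = y" by (auto simp: pm.col0_def emb_col0_def fun_eq_iff)
  moreover have "y 0 \<in> chain_set n" using y pm.TotD[of y n 0] by (simp add: pm.col0_def)
  ultimately show "y \<in> emb_col0 ` chain_set n" by (metis imageI)
qed (auto simp: pm.col0_def emb_col0_def chain_set_def intro!: pm.TotI)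

text \<open>No horizontal differential leaves column 0, so this column is a subcomplex, namely the
  one that defines \<open>CH\<close>.\<close>

lemma Dt_emb_col0:
  assumes "c \<in> chain_set (Suc n)"
  shows "pm.Dt (Suc n) (emb_col0 c) = emb_col0 (bdry C d (Suc n) c)"
proof
  fix a
  show "pm.Dt (Suc n) (emb_col0 c) a = emb_col0 (bdry C d (Suc n) c) a"
  proof (cases "a = 0")
    case True
    then show ?thesis using bdry_eq[OF assms] by (simp add: pm.Dt_def emb_col0_def pm.hor_0 pm.vert_def)
  next
    case False
    then show ?thesis
      by (simp add: pm.Dt_def emb_col0_def pm.hor_0 pm.vert_0 Suc_diff_le less_Suc_eq_le)
  qed
qed

lemma group_rank_free_precyclic: "group_rank (homology C (bdry C d) (int n)) = pm.rank_CH n"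
proof (rule group_rank_homology[OF additive_embedding_col0])
  show "emb_col0 ` (if n = 0 then carrier (C n) else kernel (C n) (C (n - 1)) (bdry C d n)) = pm.cyc.ZL n"
  proof (cases n)
    case 0
    then show ?thesis
      using emb_col0_carrier[of 0] pm.cyc.D_0 pm.cyc.L_T by (auto simp: pm.cyc.ZL_def carrier_C)
  next
    case (Suc m)
    have "bdry C d n c = 0 \<longleftrightarrow> pm.Dt n (emb_col0 c) = 0" if c: "c \<in> chain_set n" for c
      using Dt_emb_col0[of c m] c Suc by (auto simp: emb_col0_def fun_eq_iff)
    then have "kernel (C n) (C (n - 1)) (bdry C d n) = {c \<in> chain_set n. pm.Dt n (emb_col0 c) = 0}"
      by (auto simp: kernel_def carrier_C keys_iff)
    then show ?thesis unfolding pm.cyc.ZL_def emb_col0_carrier[symmetric] using Suc by auto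
  qed
  show "emb_col0 ` bdry C d (Suc n) ` carrier (C (Suc n)) = pm.cyc.BL n"
    unfolding pm.cyc.BL_def emb_col0_carrier[symmetric] image_image carrier_C
    by (rule image_cong[OF refl]) (rule Dt_emb_col0[symmetric])
  show "bdry C d (Suc n) ` carrier (C (Suc n)) \<subseteq> carrier (C n)"
    unfolding carrier_C by (rule image_subsetI) (simp add: bdry_eq pm.bd_closed)
qed (rule pm.cyc.subspace_ZL pm.cyc.subspace_BL pm.cyc.BL_ZL)+

end

section \<open>Negative degrees, and the alternating sum over all degrees\<close>

lemma group_rank_singleton_group: "group_rank (singleton_group a) = 0"
proof -
  have "S = {}" if S: "S \<subseteq> {a}" "int_independent (singleton_group a) S" for S
  proof (rule ccontr)
    interpret comm_group "singleton_group a" by simp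
    assume "S \<noteq> {}"
    then have "S = {a}" using S(1) by blast
    \<comment> \<open>In the trivial group every product is neutral, so the coefficient 1 already
      gives a nontrivial relation on \<open>{a}\<close>.\<close>
    moreover have "finprod (singleton_group a) (\<lambda>x. x [^]\<^bsub>singleton_group a\<^esub> (1::int)) {a} = \<one>\<^bsub>singleton_group a\<^esub>"
      using finprod_closed[of "\<lambda>x. x [^]\<^bsub>singleton_group a\<^esub> (1::int)" "{a}"] one_closed
      by (simp add: Pi_iff)
    ultimately show False
      using S(2)[unfolded int_independent_def, rule_format, of "\<lambda>_. 1"] by simp
  qed
  then have "group_rank (singleton_group a) \<le> 0"
    unfolding group_rank_def by (intro Sup_least) (auto simp: zero_enat_def)
  then show ?thesis by simp
qed

lemma rk_homology_neg: "k < 0 \<Longrightarrow> rk (homology C D k) = 0"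
  by (simp add: homology_def rk_def group_rank_singleton_group zero_enat_def)

lemma rk_eq_0_iff: "finite_rank G \<Longrightarrow> rk G = 0 \<longleftrightarrow> group_rank G = 0"
  unfolding finite_rank_def rk_def by (cases "group_rank G") (auto simp: zero_enat_def)

context free_precyclic
begin

lemma Euler_characteristic_homology:
  assumes fin: "\<And>i. finite_rank (homology C (bdry C d) i)"
    and vanish: "\<And>n. N \<le> n \<Longrightarrow> rk (homology C (bdry C d) n) = 0"
  shows "Sum_any (\<lambda>i :: int. (-1) powi i * real (rk (homology C (bdry C d) i)))
    = - ((-1) powi N * real (rk (homology (cc_total C) (cc_differential C d T) (N - 1)))
       + (-1) powi (N + 1) * real (rk (homology (cc_total C) (cc_differential C d T) N)))"
proof -
  let ?H = "\<lambda>i. homology C (bdry C d) i" and ?HC = "\<lambda>i. homology (cc_total C) (cc_differential C d T) i"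
  have rank_fin: "pm.rank_CH n \<noteq> \<infinity>" for n
    using fin[of "int n"] by (simp only: finite_rank_def group_rank_free_precyclic not_False_eq_True)
  have rk_H: "rk (?H (int n)) = the_enat (pm.rank_CH n)" for n
    by (simp only: rk_def group_rank_free_precyclic)
  have rk_HC: "rk (?HC (int n)) = the_enat (pm.rank_CHC n)" for n
    by (simp only: rk_def group_rank_cc_total)
  have rank_0: "pm.rank_CH n = 0" if "N \<le> int n" for n
    using vanish[OF that] rk_eq_0_iff[OF fin, of "int n"] by (simp only: group_rank_free_precyclic)
  show ?thesis
  proof (cases "N \<le> 0")
    \<comment> \<open>All ranks of \<open>CH\<close> vanish, those in negative degrees because the
      groups are trivial. If N = 0, the term for \<open>CHC\<close> in degree 0 has rank
      \<open>rank_i 0\<close>, which is 0.\<close>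
    case True
    then have "rk (?H i) = 0" for i
      using vanish[of i] rk_homology_neg[of i] by (cases "i < 0") auto
    moreover have "rk (?HC (N - 1)) = 0" using True by (intro rk_homology_neg) simp
    moreover have "rk (?HC N) = 0"
    proof (cases "N < 0")
      case False
      then have "N = int 0" using True by simp
      then show ?thesis
        using pm.rank_CHC_eq_rank_i[OF rank_fin rank_0[of 0]] pm.rank_i_0 rk_HC[of 0]
        by (simp add: zero_enat_def)
    qed (rule rk_homology_neg)
    ultimately show ?thesis by simp
  next
    case False
    \<comment> \<open>\<open>m\<close> is N - 1, the last degree in which \<open>CH\<close> can have
      nonzero rank, so the sum over all integers is the partial sum up to \<open>m\<close>.\<close>
    then obtain m where N: "N = int (Suc m)"
      by (metis gr0_implies_Suc not_le zero_less_imp_eq_int)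
    let ?f = "\<lambda>i :: int. (-1) powi i * real (rk (?H i))"
    have "{i. ?f i \<noteq> 0} \<subseteq> int ` {..m}"
    proof
      fix i assume "i \<in> {i. ?f i \<noteq> 0}"
      then have "rk (?H i) \<noteq> 0" by simp
      then have "0 \<le> i" "i < N" using rk_homology_neg vanish not_le by metis+
      then show "i \<in> int ` {..m}" using N by (auto intro!: image_eqI[of _ _ "nat i"])
    qed
    then have "Sum_any ?f = sum ?f (int ` {..m})" by (intro Sum_any.expand_superset) simp
    also have "\<dots> = (\<Sum>n\<le>m. (-1) ^ n * real (the_enat (pm.rank_CH n)))"
      by (subst sum.reindex) (auto simp: rk_H)
    also have "\<dots> = (-1) ^ m * (real (the_enat (pm.rank_CHC m)) - real (the_enat (pm.rank_CHC (Suc m))))"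
      by (rule pm.alternating_sum_CH_eq_CHC[OF rank_fin rank_0]) (simp add: N)
    also have "\<dots> = - ((-1) powi N * real (rk (?HC (N - 1))) + (-1) powi (N + 1) * real (rk (?HC N)))"
    proof -
      have "N - 1 = int m" "N + 1 = int (Suc (Suc m))" using N by simp_all
      then show ?thesis unfolding N rk_HC by (simp only: power_int_of_nat rk_HC) (simp add: algebra_simps)
    qed
    finally show ?thesis .
  qed
qed

end

theorem theorem4p13:
  fixes \<XX> :: "('p, 'a) ringed_space" and d :: nat and r N :: int and \<zeta> :: "complex \<Rightarrow> complex"
  assumes "finite_type_scheme \<XX>"
    and "krull_dim (space_top \<XX>) = enat d"
    and "zeta_meromorphic_at \<XX> \<zeta> (of_int (int d - r))"
    and "CH_can_be_defined \<XX> r"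
    and "\<forall>i. finite_rank (CH \<XX> r i)"
    and "\<forall>n \<ge> N. rk (CH \<XX> r n) = 0"
  shows "- real_of_int (zorder \<zeta> (of_int (int d - r)))
           = Sum_any (\<lambda>i :: int. (-1) powi i * real (rk (CH \<XX> r i)))
     \<longleftrightarrow> real_of_int (zorder \<zeta> (of_int (int d - r)))
           = (-1) powi N * real (rk (CHC \<XX> r (N - 1)))
             + (-1) powi (N + 1) * real (rk (CHC \<XX> r N))"
proof -
  \<comment> \<open>The cycle groups are free on the admissible subvarieties, which makes
    \<open>CH_can_be_defined\<close> an instance of \<open>free_precyclic\<close>.\<close>
  have groups: "cycle_group \<XX> r = (\<lambda>n. free_Abelian_group (admissible_subvarieties \<XX> r n))"
    by (simp add: cycle_group_def fun_eq_iff)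
  interpret free_precyclic "admissible_subvarieties \<XX> r" "cycle_face \<XX>" "cycle_cyclic \<XX>" "cycle_degeneracy \<XX>"
    using assms(4) unfolding free_precyclic_def CH_can_be_defined_def groups .
  have "Sum_any (\<lambda>i :: int. (-1) powi i * real (rk (CH \<XX> r i)))
      = - ((-1) powi N * real (rk (CHC \<XX> r (N - 1))) + (-1) powi (N + 1) * real (rk (CHC \<XX> r N)))"
    using assms(5,6) unfolding CH_def CHC_def groups
    by (intro Euler_characteristic_homology) simp_all
  \<comment> \<open>The alternating sum is minus the expression in \<open>CHC\<close>, so the two
    equations for the order differ only by an overall sign.\<close>
  then show ?thesis by linarith
qed

end
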